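(* Thompson's group $F$ is not strongly relatively hyperbolic.
   Context: Thompson's group $F$ is the finitely presented, torsion-free group of orientation-preserving piecewise-linear homeomorphisms of the unit interval $[0,1]$ with finitely many breakpoints, all at dyadic rationals, and all slopes powers of $2$; it has the infinite presentation $F=\langle x_0,x_1,x_2,\ldots\mid x_{j+1}=x_ix_jx_i^{-1},\ i<j\rangle$. A finitely generated group is called not strongly relatively hyperbolic if it is not strongly hyperbolic relative to any finite collection of proper finitely generated subgroups. Here a group $G$ is strongly hyperbolic relative to a family $L_1,\dots,L_m$ ($m\ge 1$) of proper finitely generated subgroups if $G$ admits an action on a connected graph $\mathcal{G}$ such that: $\mathcal{G}$ (with all edges of length one) is hyperbolic in the sense of Gromov; $\mathcal{G}$ is fine, i.e. for each $n\in\mathbf{N}$ each edge of $\mathcal{G}$ belongs to only finitely many circuits (closed edge paths without repeated vertices) of length $n$; there are only finitely many $G$-orbits of edges; each edge stabiliser is finite; and the stabilisers of the vertices of infinite valence are precisely the conjugates of the $L_j$. *)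

theory Defs
  imports "HOL-Analysis.Analysis" "HOL-Algebra.Group_Action" "HOL-Algebra.Generated_Groups"
begin

section \<open>Thompson's group\<close>

definition dyadic :: "real set" where
  "dyadic = {of_int m / 2 ^ n | (m::int) (n::nat). True}"

text \<open>
  The set \<open>B\<close> contains all breakpoints: on every interval whose interior misses \<open>B\<close> the map is
  affine.
\<close>

definition dyadic_PL :: "(real \<Rightarrow> real) \<Rightarrow> bool" where
  "dyadic_PL f \<longleftrightarrow>
     (\<exists>B. finite B \<and> B \<subseteq> dyadic \<and>
        (\<forall>a b. 0 \<le> a \<and> a < b \<and> b \<le> 1 \<and> {a<..<b} \<inter> B = {} \<longrightarrow>
           (\<exists>(k::int) c. \<forall>x\<in>{a..b}. f x = 2 powi k * x + c)))"

text \<open>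
  Maps are restricted to the unit interval by extensionality, as in \<^const>\<open>BijGroup\<close>, whose
  multiplication is composition.
\<close>

definition thompson_carrier :: "(real \<Rightarrow> real) set" where
  "thompson_carrier =
     {f \<in> extensional {0..1}.
        (\<exists>g. homeomorphism {0..1} {0..1} f g) \<and> strict_mono_on {0..1} f \<and> dyadic_PL f}"

definition thompson_F :: "(real \<Rightarrow> real) monoid" where
  "thompson_F = BijGroup {0..1} \<lparr>carrier := thompson_carrier\<rparr>"

lemma dyadic_0: "0 \<in> dyadic" and dyadic_1: "1 \<in> dyadic"
proof -
  have "0 = of_int 0 / (2::real) ^ 0" "1 = of_int 1 / (2::real) ^ 0" by auto
  then show "0 \<in> dyadic" "1 \<in> dyadic" unfolding dyadic_def by blast+
qed

lemma dyadic_add: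
  assumes "x \<in> dyadic" "y \<in> dyadic" shows "x + y \<in> dyadic"
proof -
  obtain m n p q where xy: "x = of_int m / 2 ^ n" "y = of_int p / 2 ^ q"
    using assms by (auto simp: dyadic_def)
  have "x + y = of_int (m * 2 ^ q + p * 2 ^ n) / 2 ^ (n + q)"
    unfolding xy by (simp add: add_frac_eq power_add)
  then show ?thesis unfolding dyadic_def by blast
qed

lemma dyadic_minus: "x \<in> dyadic \<Longrightarrow> - x \<in> dyadic"
  unfolding dyadic_def by clarsimp (metis minus_divide_left of_int_minus)

lemma dyadic_powi_mult:
  assumes "x \<in> dyadic" shows "2 powi k * x \<in> dyadic"
proof -
  obtain m n where x: "x = of_int m / 2 ^ n"
    using assms by (auto simp: dyadic_def)
  show ?thesis
  proof (cases "k \<ge> 0")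
    case True
    then have "2 powi k * x = of_int (m * 2 ^ nat k) / 2 ^ n"
      by (simp add: x power_int_def)
    then show ?thesis unfolding dyadic_def by blast
  next
    case False
    then have "2 powi k * x = of_int m / 2 ^ (n + nat (- k))"
      by (simp add: x power_int_def power_add field_simps)
    then show ?thesis unfolding dyadic_def by blast
  qed
qed

lemma thompson_homeomorphism:
  assumes "f \<in> thompson_carrier"
  shows "homeomorphism {0..1} {0..1} f (inv_into {0..1} f)"
proof -
  obtain g where g: "homeomorphism {0..1} {0..1} f g"
    using assms by (auto simp: thompson_carrier_def)
  have "inv_into {0..1} f y = g y" if "y \<in> {0..1}" for y
    using g that unfolding homeomorphism_def
    by (metis image_eqI inv_into_f_f inj_on_inverseI)
  then show ?thesis by (intro homeomorphism_cong[OF g]) simp_all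
qed

lemma thompson_less_iff:
  assumes "f \<in> thompson_carrier" "x \<in> {0..1}" "y \<in> {0..1}"
  shows "f x < f y \<longleftrightarrow> x < y"
  using assms unfolding thompson_carrier_def
  by (auto simp: strict_mono_on_less)

lemma thompson_endpoints:
  assumes "f \<in> thompson_carrier"
  shows "f 0 = 0" "f 1 = 1"
proof -
  have h: "f ` {0..1} = {0..1}"
    using thompson_homeomorphism[OF assms] by (auto simp: homeomorphism_def)
  have "0 \<in> f ` {0..1}" "1 \<in> f ` {0..1}" unfolding h by simp_all
  then obtain x y where x: "x \<in> {0..1}" "f x = 0" and y: "y \<in> {0..1}" "f y = 1"
    by (metis imageE)
  have "f 0 \<in> f ` {0..1}" "f 1 \<in> f ` {0..1}" by simp_all
  then have "\<not> f 0 < f x" "\<not> f y < f 1" unfolding h using x y by simp_all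
  then have "x = 0" "y = 1"
    using thompson_less_iff[OF assms _ x(1), of 0] thompson_less_iff[OF assms y(1), of 1] x y
    by simp_all
  then show "f 0 = 0" "f 1 = 1" using x y by simp_all
qed

lemma thompson_dyadic:
  assumes f: "f \<in> thompson_carrier" and x: "x \<in> {0..1} \<inter> dyadic"
  shows "f x \<in> dyadic"
proof -
  obtain B where B: "finite B" "B \<subseteq> dyadic" and PL:
    "\<And>a b. \<lbrakk>0 \<le> a; a < b; b \<le> 1; {a<..<b} \<inter> B = {}\<rbrakk> \<Longrightarrow>
           \<exists>(k::int) c. \<forall>x\<in>{a..b}. f x = 2 powi k * x + c"
    using f unfolding thompson_carrier_def dyadic_PL_def by auto
  have main: "f y \<in> dyadic" if "card {b \<in> B. 0 < b \<and> b < y} = n" "y \<in> {0..1} \<inter> dyadic" for n y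
    using that
  proof (induction n arbitrary: y rule: less_induct)
    case (less n)
    show ?case
    proof (cases "y = 0")
      case True
      then show ?thesis using thompson_endpoints[OF f] dyadic_0 by simp
    next
      case False
      define a where "a = Max (insert 0 {b \<in> B. 0 < b \<and> b < y})"
      have fin: "finite (insert 0 {b \<in> B. 0 < b \<and> b < y})" using B by simp
      then have a: "a \<in> insert 0 {b \<in> B. 0 < b \<and> b < y}"
        unfolding a_def by (rule Max_in) simp
      then have ay: "0 \<le> a" "a < y" "a \<in> dyadic" using False less B dyadic_0 by auto
      have max: "b \<le> a" if "b \<in> B" "0 < b" "b < y" for b
        unfolding a_def using fin that by (intro Max_ge) auto
      have "{a<..<y} \<inter> B = {}" using max ay by fastforce
      then obtain k :: int and c where kc: "\<forall>x\<in>{a..y}. f x = 2 powi k * x + c"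
        using PL[of a y] ay less by auto
      have fa: "f a \<in> dyadic"
      proof (cases "a = 0")
        case True
        then show ?thesis using thompson_endpoints[OF f] dyadic_0 by simp
      next
        case False
        then have "a \<in> {b \<in> B. 0 < b \<and> b < y}" using a by blast
        moreover have "{b \<in> B. 0 < b \<and> b < a} \<subseteq> {b \<in> B. 0 < b \<and> b < y} - {a}"
          using ay(2) by fastforce
        ultimately have "{b \<in> B. 0 < b \<and> b < a} \<subset> {b \<in> B. 0 < b \<and> b < y}" by blast
        then have lt: "card {b \<in> B. 0 < b \<and> b < a} < n"
          unfolding less.prems(1)[symmetric] using B(1) by (intro psubset_card_mono) simp_all
        have "a \<in> {0..1} \<inter> dyadic" using ay less.prems(2) by simp
        then show ?thesis using less.IH[OF lt refl] by blast
      qed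
      have fy: "f y = f a + 2 powi k * (y + - a)"
        using kc ay by (simp add: algebra_simps)
      have "y \<in> dyadic" using less.prems(2) by simp
      then show ?thesis
        unfolding fy by (intro dyadic_add dyadic_powi_mult dyadic_minus fa ay(3))
    qed
  qed
  show ?thesis using main[OF refl x] .
qed

lemma thompson_id: "(\<lambda>x\<in>{0..1}. x) \<in> thompson_carrier"
proof -
  have "homeomorphism {0..1::real} {0..1} (\<lambda>x\<in>{0..1}. x) (\<lambda>x. x)"
    by (rule homeomorphism_cong[OF homeomorphism_ident]) auto
  moreover have "dyadic_PL (\<lambda>x\<in>{0..1}. x)"
    unfolding dyadic_PL_def
    by (rule exI[of _ "{}"]) (auto intro!: exI[of _ "0::int"] exI[of _ "0::real"])
  ultimately show ?thesis
    unfolding thompson_carrier_def by (auto simp: strict_mono_on_def)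
qed

lemma thompson_inv:
  assumes f: "f \<in> thompson_carrier"
  shows "(\<lambda>x\<in>{0..1}. inv_into {0..1} f x) \<in> thompson_carrier"
proof -
  define g where "g = inv_into {0..1} f"
  have h: "homeomorphism {0..1} {0..1} f g"
    unfolding g_def by (rule thompson_homeomorphism[OF f])
  then have g: "g y \<in> {0..1}" "f (g y) = y" if "y \<in> {0..1}" for y
    using that by (auto simp: homeomorphism_def)
  have fx: "f x \<in> {0..1}" "g (f x) = x" if "x \<in> {0..1}" for x
    using h that by (auto simp: homeomorphism_def)
  have less: "g x < g y \<longleftrightarrow> x < y" if "x \<in> {0..1}" "y \<in> {0..1}" for x y
    using thompson_less_iff[OF f g(1)[OF that(1)] g(1)[OF that(2)]] g(2) that by simp
  obtain B where B: "finite B" "B \<subseteq> dyadic" and PL: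
    "\<And>a b. \<lbrakk>0 \<le> a; a < b; b \<le> 1; {a<..<b} \<inter> B = {}\<rbrakk> \<Longrightarrow>
           \<exists>(k::int) c. \<forall>x\<in>{a..b}. f x = 2 powi k * x + c"
    using f unfolding thompson_carrier_def dyadic_PL_def by auto
  have "dyadic_PL (\<lambda>x\<in>{0..1}. g x)"
    unfolding dyadic_PL_def
  proof (rule exI, intro conjI allI impI)
    show "finite (f ` (B \<inter> {0..1}))" using B by simp
    show "f ` (B \<inter> {0..1}) \<subseteq> dyadic" using thompson_dyadic[OF f] B by auto
    fix a b :: real assume ab: "0 \<le> a \<and> a < b \<and> b \<le> 1 \<and> {a<..<b} \<inter> f ` (B \<inter> {0..1}) = {}"
    then have ab': "a \<in> {0..1}" "b \<in> {0..1}" by auto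
    have "{g a<..<g b} \<inter> B = {}"
    proof safe
      fix x assume x: "x \<in> {g a<..<g b}" "x \<in> B"
      then have "x \<in> {0..1}" using g(1)[OF ab'(1)] g(1)[OF ab'(2)] by auto
      moreover from this have "a < f x" "f x < b"
        using thompson_less_iff[OF f g(1)[OF ab'(1)], of x]
          thompson_less_iff[OF f _ g(1)[OF ab'(2)], of x] x g(2) ab' by auto
      ultimately show "x \<in> {}" using ab x by auto
    qed
    then obtain k :: int and c where kc: "\<forall>x\<in>{g a..g b}. f x = 2 powi k * x + c"
      using PL[of "g a" "g b"] less[OF ab'] g(1)[OF ab'(1)] g(1)[OF ab'(2)] ab by auto
    have "(\<lambda>x\<in>{0..1}. g x) y = 2 powi (- k) * y + - (2 powi (- k) * c)" if y: "y \<in> {a..b}" for y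
    proof -
      have y': "y \<in> {0..1}" using y ab by auto
      then have "g y \<in> {g a..g b}" using less[OF ab'(2) y'] less[OF y' ab'(1)] y by auto
      then have "y = 2 powi k * g y + c" using kc g(2)[OF y'] by metis
      then have "2 powi (- k) * y = g y + 2 powi (- k) * c"
        by (simp add: power_int_minus field_simps)
      then show ?thesis using y' by simp
    qed
    then show "\<exists>(k::int) c. \<forall>x\<in>{a..b}. (\<lambda>x\<in>{0..1}. g x) x = 2 powi k * x + c" by blast
  qed
  moreover have "homeomorphism {0..1} {0..1} (\<lambda>x\<in>{0..1}. g x) f"
    by (rule homeomorphism_cong[OF homeomorphism_symD[OF h]]) auto
  ultimately show ?thesis
    unfolding thompson_carrier_def g_def[symmetric]
    using less by (auto simp: strict_mono_on_def)
qed

lemma thompson_compose: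
  assumes f: "f \<in> thompson_carrier" and g: "g \<in> thompson_carrier"
  shows "compose {0..1} f g \<in> thompson_carrier"
proof -
  define h where "h = inv_into {0..1} g"
  have hg: "homeomorphism {0..1} {0..1} g h"
    unfolding h_def by (rule thompson_homeomorphism[OF g])
  then have gx: "g x \<in> {0..1}" "h (g x) = x" if "x \<in> {0..1}" for x
    using that by (auto simp: homeomorphism_def)
  have hx: "h x \<in> dyadic" if "x \<in> {0..1} \<inter> dyadic" for x
    using thompson_dyadic[OF thompson_inv[OF g]] that unfolding h_def by force
  obtain A where A: "finite A" "A \<subseteq> dyadic" and PLf:
    "\<And>a b. \<lbrakk>0 \<le> a; a < b; b \<le> 1; {a<..<b} \<inter> A = {}\<rbrakk> \<Longrightarrow>
           \<exists>(k::int) c. \<forall>x\<in>{a..b}. f x = 2 powi k * x + c"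
    using f unfolding thompson_carrier_def dyadic_PL_def by auto
  obtain B where B: "finite B" "B \<subseteq> dyadic" and PLg:
    "\<And>a b. \<lbrakk>0 \<le> a; a < b; b \<le> 1; {a<..<b} \<inter> B = {}\<rbrakk> \<Longrightarrow>
           \<exists>(k::int) c. \<forall>x\<in>{a..b}. g x = 2 powi k * x + c"
    using g unfolding thompson_carrier_def dyadic_PL_def by auto
  have "dyadic_PL (compose {0..1} f g)"
    unfolding dyadic_PL_def
  proof (rule exI, intro conjI allI impI)
    show "finite (B \<union> h ` (A \<inter> {0..1}))" using A B by simp
    show "B \<union> h ` (A \<inter> {0..1}) \<subseteq> dyadic" using hx A B by auto
    fix a b :: real
    assume ab: "0 \<le> a \<and> a < b \<and> b \<le> 1 \<and> {a<..<b} \<inter> (B \<union> h ` (A \<inter> {0..1})) = {}"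
    then have ab': "a \<in> {0..1}" "b \<in> {0..1}" by auto
    obtain k :: int and c where kc: "\<forall>x\<in>{a..b}. g x = 2 powi k * x + c"
      using PLg[of a b] ab by auto
    have "{g a<..<g b} \<inter> A = {}"
    proof safe
      fix y assume y: "y \<in> {g a<..<g b}" "y \<in> A"
      then have y': "y \<in> {0..1}" using gx(1)[OF ab'(1)] gx(1)[OF ab'(2)] by auto
      then have hy: "h y \<in> {0..1}" "g (h y) = y" using hg by (auto simp: homeomorphism_def)
      then have "a < h y" "h y < b"
        using thompson_less_iff[OF g ab'(1) hy(1)] thompson_less_iff[OF g hy(1) ab'(2)] y by auto
      then show "y \<in> {}" using ab y y' by auto
    qed
    then obtain l :: int and d where ld: "\<forall>x\<in>{g a..g b}. f x = 2 powi l * x + d"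
      using PLf[of "g a" "g b"] thompson_less_iff[OF g ab'] gx(1)[OF ab'(1)] gx(1)[OF ab'(2)] ab
      by auto
    have "compose {0..1} f g x = 2 powi (l + k) * x + (2 powi l * c + d)" if x: "x \<in> {a..b}" for x
    proof -
      have x': "x \<in> {0..1}" using x ab by auto
      then have "g x \<in> {g a..g b}"
        using thompson_less_iff[OF g ab'(2) x'] thompson_less_iff[OF g x' ab'(1)] x by auto
      then have "f (g x) = 2 powi l * (2 powi k * x + c) + d" using ld kc x by auto
      then show ?thesis using x' by (simp add: compose_def power_int_add algebra_simps)
    qed
    then show "\<exists>(k::int) c. \<forall>x\<in>{a..b}. compose {0..1} f g x = 2 powi k * x + c" by blast
  qed
  moreover have "homeomorphism {0..1} {0..1} (compose {0..1} f g) (h \<circ> inv_into {0..1} f)"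
    by (rule homeomorphism_cong[OF homeomorphism_compose[OF hg thompson_homeomorphism[OF f]]])
      (auto simp: compose_def)
  moreover have "strict_mono_on {0..1} (compose {0..1} f g)"
    using thompson_less_iff[OF f gx(1) gx(1)] thompson_less_iff[OF g]
    by (auto simp: strict_mono_on_def compose_def)
  ultimately show ?thesis
    unfolding thompson_carrier_def by auto
qed

lemma thompson_carrier_Bij: "thompson_carrier \<subseteq> Bij {0..1}"
proof
  fix f assume f: "f \<in> thompson_carrier"
  have "bij_betw f {0..1} {0..1}"
    unfolding bij_betw_def using thompson_homeomorphism[OF f]
    by (auto simp: homeomorphism_def intro: inj_on_inverseI)
  with f show "f \<in> Bij {0..1}" by (simp add: Bij_def thompson_carrier_def)
qed

lemma subgroup_thompson: "subgroup thompson_carrier (BijGroup {0..1})"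
proof (rule group.subgroupI[OF group_BijGroup])
  show "thompson_carrier \<subseteq> carrier (BijGroup {0..1})"
    using thompson_carrier_Bij by (simp add: BijGroup_def)
  show "thompson_carrier \<noteq> {}" using thompson_id by blast
  show "inv\<^bsub>BijGroup {0..1}\<^esub> f \<in> thompson_carrier" if "f \<in> thompson_carrier" for f
    using that thompson_inv thompson_carrier_Bij by (auto simp: inv_BijGroup)
  show "f \<otimes>\<^bsub>BijGroup {0..1}\<^esub> g \<in> thompson_carrier"
    if "f \<in> thompson_carrier" "g \<in> thompson_carrier" for f g
    using that thompson_compose[OF that] thompson_carrier_Bij by (auto simp: BijGroup_def)
qed

lemma group_thompson_F: "group thompson_F"
  unfolding thompson_F_def
  by (rule group.subgroup_imp_group[OF group_BijGroup subgroup_thompson])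


section \<open>Simple graphs and the path metric\<close>

definition simple_graph :: "'v set \<Rightarrow> 'v set set \<Rightarrow> bool" where
  "simple_graph V E \<longleftrightarrow> (\<forall>e\<in>E. \<exists>u\<in>V. \<exists>v\<in>V. u \<noteq> v \<and> e = {u, v})"

definition adj :: "'v set set \<Rightarrow> ('v \<times> 'v) set" where
  "adj E = {(u, v). {u, v} \<in> E}"

definition connected_graph :: "'v set \<Rightarrow> 'v set set \<Rightarrow> bool" where
  "connected_graph V E \<longleftrightarrow> V \<noteq> {} \<and> (\<forall>u\<in>V. \<forall>v\<in>V. (u, v) \<in> (adj E)\<^sup>*)"

definition graph_dist :: "'v set set \<Rightarrow> 'v \<Rightarrow> 'v \<Rightarrow> nat" where
  "graph_dist E u v = (LEAST n. (u, v) \<in> adj E ^^ n)"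

definition infinite_valence :: "'v set set \<Rightarrow> 'v \<Rightarrow> bool" where
  "infinite_valence E v \<longleftrightarrow> infinite {e \<in> E. v \<in> e}"

text \<open>
  Gromov hyperbolicity refers to the geometric realization, all edges having length one. The
  triple \<open>(u, v, s)\<close> stands for the point at distance \<open>s\<close> from \<open>u\<close> on the edge \<open>{u, v}\<close>, so
  \<open>(u, v, s)\<close> and \<open>(v, u, 1 - s)\<close> are the same point and have distance \<open>0\<close>. Points on distinct
  edges are joined by a shortest path through one endpoint of each edge. (A connected graph without
  edges is a single vertex; it has no such triples and is hyperbolic.)
\<close>

definition edge_points :: "'v set set \<Rightarrow> ('v \<times> 'v \<times> real) set" where
  "edge_points E = {(u, v, s). {u, v} \<in> E \<and> 0 \<le> s \<and> s \<le> 1}"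

definition realization_dist :: "'v set set \<Rightarrow> 'v \<times> 'v \<times> real \<Rightarrow> 'v \<times> 'v \<times> real \<Rightarrow> real" where
  "realization_dist E = (\<lambda>(u, v, s) (a, b, t).
     if u = a \<and> v = b then \<bar>s - t\<bar>
     else if u = b \<and> v = a then \<bar>s - (1 - t)\<bar>
     else Min {s + real (graph_dist E u a) + t,
               s + real (graph_dist E u b) + (1 - t),
               (1 - s) + real (graph_dist E v a) + t,
               (1 - s) + real (graph_dist E v b) + (1 - t)})"

definition gromov_product :: "('p \<Rightarrow> 'p \<Rightarrow> real) \<Rightarrow> 'p \<Rightarrow> 'p \<Rightarrow> 'p \<Rightarrow> real" where
  "gromov_product d w x y = (d x w + d y w - d x y) / 2"

definition gromov_hyperbolic :: "'p set \<Rightarrow> ('p \<Rightarrow> 'p \<Rightarrow> real) \<Rightarrow> bool" where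
  "gromov_hyperbolic X d \<longleftrightarrow>
     (\<exists>\<delta>. \<forall>w\<in>X. \<forall>x\<in>X. \<forall>y\<in>X. \<forall>z\<in>X.
        gromov_product d w x z \<ge> min (gromov_product d w x y) (gromov_product d w y z) - \<delta>)"

text \<open>
  A circuit of length \<open>n\<close> is given by its list of \<open>n\<close> vertices, closed up cyclically. A circuit in
  the sense of a subgraph corresponds to at most \<open>2 * n\<close> such lists (choice of base point and
  direction), so finiteness does not depend on the reading. Lists of length two run along a single
  edge and back, and affect no finiteness either.
\<close>

definition circuit_edges :: "'v list \<Rightarrow> 'v set set" where
  "circuit_edges c = {{c ! i, c ! (Suc i mod length c)} | i. i < length c}"

definition circuit :: "'v set set \<Rightarrow> 'v list \<Rightarrow> bool" where
  "circuit E c \<longleftrightarrow> distinct c \<and> circuit_edges c \<subseteq> E"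

definition fine_graph :: "'v set set \<Rightarrow> bool" where
  "fine_graph E \<longleftrightarrow>
     (\<forall>n. \<forall>e\<in>E. finite {c. circuit E c \<and> length c = n \<and> e \<in> circuit_edges c})"


section \<open>Strong relative hyperbolicity\<close>

definition graph_action ::
  "('g, 'b) monoid_scheme \<Rightarrow> 'v set \<Rightarrow> 'v set set \<Rightarrow> ('g \<Rightarrow> 'v \<Rightarrow> 'v) \<Rightarrow> bool" where
  "graph_action G V E \<phi> \<longleftrightarrow>
     group_action G V \<phi> \<and> (\<forall>g\<in>carrier G. \<forall>e\<in>E. \<phi> g ` e \<in> E)"

definition edge_action :: "('g \<Rightarrow> 'v \<Rightarrow> 'v) \<Rightarrow> 'g \<Rightarrow> 'v set \<Rightarrow> 'v set" where
  "edge_action \<phi> g e = \<phi> g ` e"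

definition proper_fg_subgroup :: "'g set \<Rightarrow> ('g, 'b) monoid_scheme \<Rightarrow> bool" where
  "proper_fg_subgroup L G \<longleftrightarrow>
     subgroup L G \<and> L \<noteq> carrier G \<and> (\<exists>S. finite S \<and> S \<subseteq> carrier G \<and> L = generate G S)"

definition conjugates :: "('g, 'b) monoid_scheme \<Rightarrow> 'g set set \<Rightarrow> 'g set set" where
  "conjugates G \<L> = {g <#\<^bsub>G\<^esub> L #>\<^bsub>G\<^esub> (inv\<^bsub>G\<^esub> g) | g L. g \<in> carrier G \<and> L \<in> \<L>}"

text \<open>
  The vertices of the graph have the type \<open>'v\<close>, which a definition cannot quantify over; the type
  argument makes it explicit.
\<close>

definition strongly_hyperbolic_relative ::
  "'v itself \<Rightarrow> ('g, 'b) monoid_scheme \<Rightarrow> 'g set set \<Rightarrow> bool" where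
  "strongly_hyperbolic_relative (_ :: 'v itself) G \<L> \<longleftrightarrow>
     (\<exists>(V :: 'v set) E \<phi>.
        simple_graph V E \<and> connected_graph V E \<and> graph_action G V E \<phi> \<and>
        gromov_hyperbolic (edge_points E) (realization_dist E) \<and>
        fine_graph E \<and>
        finite (orbits G E (edge_action \<phi>)) \<and>
        (\<forall>e\<in>E. finite (stabilizer G (edge_action \<phi>) e)) \<and>
        {stabilizer G \<phi> v | v. v \<in> V \<and> infinite_valence E v} = conjugates G \<L>)"

text \<open>
  The notion makes sense for every group; the terminology is customary for finitely generated ones.
\<close>

definition not_strongly_relatively_hyperbolic ::
  "'v itself \<Rightarrow> ('g, 'b) monoid_scheme \<Rightarrow> bool" where
  "not_strongly_relatively_hyperbolic T G \<longleftrightarrow>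
     \<not> (\<exists>\<L>. finite \<L> \<and> \<L> \<noteq> {} \<and> (\<forall>L\<in>\<L>. proper_fg_subgroup L G) \<and>
            strongly_hyperbolic_relative T G \<L>)"

end

theory Submission
  imports Defs
begin

text \<open>
  Since \<open>F\<close> is torsion-free, edge stabilisers are trivial. In a fine graph this forces a nontrivial
  element to fix at most one vertex, so a fixed vertex is passed on between commuting elements, and
  forces an element with a bounded orbit to fix a vertex. If \<open>a\<close> and \<open>b\<close> generate a free abelian
  group of rank two, then \<open>a\<close> has bounded orbits: otherwise take a long geodesic from \<open>x\<close> to
  \<open>a\<^sup>n x\<close>. By hyperbolicity its middle part stays close to all its translates by
  \<open>a\<^sup>i b\<^sup>j\<close> with \<open>i, j \<le> K\<close>, and fineness leaves only linearly (in \<open>K\<close>) many possibilities for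
  a pair of an edge of the geodesic and its translate near the middle edge, whereas there are
  quadratically many translates and each of them is determined by its pair.

  Let \<open>a\<close> be supported in \<open>[0, 1/2]\<close>. Any two conjugates of \<open>a\<close> commute with a common nontrivial
  element supported near \<open>1\<close>, so all conjugates of \<open>a\<close> fix the same vertex and hence \<open>F\<close> fixes
  it. A vertex of infinite valence has a nontrivial stabiliser, hence is this vertex; but its
  stabiliser is conjugate to a proper subgroup.
\<close>

section \<open>Walks and circuits\<close>

lemma relpow_map:
  assumes "(s, t) \<in> R ^^ n" "\<And>a b. (a, b) \<in> R \<Longrightarrow> (F a, F b) \<in> S"
  shows "(F s, F t) \<in> S ^^ n"
  using assms(1) by (induction n arbitrary: t) (auto intro: assms(2))

lemma relpow_segment:
  assumes "\<And>i. i < n \<Longrightarrow> (f i, f (Suc i)) \<in> R" "i \<le> j" "j \<le> n"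
  shows "(f i, f j) \<in> R ^^ (j - i)"
  unfolding relpow_fun_conv using assms by (intro exI[of _ "\<lambda>k. f (i + k)"]) auto

lemma relpow_trans: "(u, v) \<in> R ^^ m \<Longrightarrow> (v, w) \<in> R ^^ n \<Longrightarrow> (u, w) \<in> R ^^ (m + n)"
  by (auto simp: relpow_add)

lemma adj_iff: "(u, v) \<in> adj E \<longleftrightarrow> {u, v} \<in> E"
  by (simp add: adj_def)

lemma adj_relpow_sym: "(u, v) \<in> adj E ^^ n \<Longrightarrow> (v, u) \<in> adj E ^^ n"
proof (induction n arbitrary: v)
  case (Suc n)
  then obtain z where "(u, z) \<in> adj E ^^ n" "(z, v) \<in> adj E" by auto
  then show ?case
    using Suc.IH by (intro relpow_Suc_I2[of v z]) (auto simp: adj_iff insert_commute)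
qed simp

lemma adj_relpow_mono: "(u, v) \<in> adj H ^^ n \<Longrightarrow> H \<subseteq> H' \<Longrightarrow> (u, v) \<in> adj H' ^^ n"
  by (erule relpow_map[where F = "\<lambda>x. x"]) (auto simp: adj_iff)

lemma graph_dist_le: "(u, v) \<in> adj E ^^ n \<Longrightarrow> graph_dist E u v \<le> n"
  unfolding graph_dist_def by (rule Least_le)

text \<open>Fineness enters the proof only through the finiteness of these sets. The length is
  bounded rather than prescribed because shortest walks are only estimated from above.\<close>

definition near :: "'v set set \<Rightarrow> nat \<Rightarrow> 'v set \<Rightarrow> 'v set set" where
  "near E n e = \<Union> {circuit_edges c | c. circuit E c \<and> length c \<le> n \<and> e \<in> circuit_edges c}"

lemma finite_near:
  assumes "fine_graph E" "e \<in> E"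
  shows "finite (near E n e)"
proof -
  have "{c. circuit E c \<and> length c \<le> n \<and> e \<in> circuit_edges c} =
      (\<Union>m\<le>n. {c. circuit E c \<and> length c = m \<and> e \<in> circuit_edges c})" by auto
  then have "finite {c. circuit E c \<and> length c \<le> n \<and> e \<in> circuit_edges c}"
    using assms by (simp add: fine_graph_def)
  then show ?thesis
    unfolding near_def by (rule finite_Union[OF finite_image_set]) (auto simp: circuit_edges_def)
qed

lemma near_subset: "near E n e \<subseteq> E"
  by (auto simp: near_def circuit_def)

text \<open>A shortest walk in \<open>H\<close> from \<open>p\<close> to \<open>q\<close> closes up along \<open>{p, q}\<close> to a circuit.\<close>

lemma crossing_edge:
  assumes H: "H \<subseteq> E" and walk: "(p, q) \<in> adj H ^^ n" and pq: "p \<in> A" "q \<notin> A" "{p, q} \<in> E"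
  obtains f where "f \<in> H" "f \<in> near E (Suc n) {p, q}" "f \<inter> A \<noteq> {}" "\<not> f \<subseteq> A"
proof -
  define m where "m = graph_dist H p q"
  have mn: "m \<le> n" unfolding m_def using walk by (rule graph_dist_le)
  have "(p, q) \<in> adj H ^^ m" unfolding m_def graph_dist_def using walk by (rule LeastI)
  then obtain f where f: "f 0 = p" "f m = q" and step: "\<And>i. i < m \<Longrightarrow> (f i, f (Suc i)) \<in> adj H"
    unfolding relpow_fun_conv by auto
  \<comment> \<open>Cutting out the loop between two equal vertices would leave a walk shorter than
    \<open>m\<close>.\<close>
  have neq: "f i \<noteq> f j" if "i < j" "j \<le> m" for i j
  proof
    assume eq: "f i = f j"
    have "(f 0, f i) \<in> adj H ^^ (i - 0)"
      by (rule relpow_segment[of m f]) (use that step in auto)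
    moreover have "(f j, f m) \<in> adj H ^^ (m - j)"
      by (rule relpow_segment[of m f]) (use that step in auto)
    ultimately have "(p, q) \<in> adj H ^^ (i + (m - j))"
      using eq f by (auto intro: relpow_trans)
    then have "m \<le> i + (m - j)" unfolding m_def by (rule graph_dist_le)
    then show False using that by simp
  qed
  define c where "c = map f [0..<Suc m]"
  have len: "length c = Suc m" by (simp add: c_def)
  have nth: "c ! i = f i" if "i \<le> m" for i
    unfolding c_def using that by (metis add_0 diff_zero less_Suc_eq_le nth_map_upt)
  have edges: "{f i, f (Suc i)} \<in> circuit_edges c" if "i < m" for i
    unfolding circuit_edges_def using that by (auto simp: len nth intro!: exI[of _ i])
  have pqc: "{p, q} \<in> circuit_edges c"
    unfolding circuit_edges_def using f by (auto simp: len nth intro!: exI[of _ m])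
  have "circuit_edges c \<subseteq> insert {p, q} H"
  proof
    fix e assume "e \<in> circuit_edges c"
    then obtain i where i: "i \<le> m" "e = {c ! i, c ! (Suc i mod Suc m)}"
      unfolding circuit_edges_def len by (auto simp: less_Suc_eq_le)
    show "e \<in> insert {p, q} H"
    proof (cases "i = m")
      case True
      then show ?thesis using i f by (auto simp: nth)
    next
      case False
      then show ?thesis using i step[of i] by (auto simp: nth adj_iff)
    qed
  qed
  moreover have "distinct c"
    unfolding c_def distinct_map using neq
    by (auto simp del: upt_Suc intro!: linorder_inj_onI)
  ultimately have circ: "circuit E c" unfolding circuit_def using H pq by auto
  \<comment> \<open>The walk starts in \<open>A\<close> and ends outside, so one of its steps leaves
    \<open>A\<close>.\<close>
  have "\<exists>i<m. f i \<in> A \<and> f (Suc i) \<notin> A"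
  proof (rule ccontr)
    assume *: "\<not> ?thesis"
    have "i \<le> m \<longrightarrow> f i \<in> A" for i
      by (induction i) (use * f pq in \<open>auto simp: Suc_le_eq\<close>)
    then show False using f pq by auto
  qed
  then obtain i where i: "i < m" "f i \<in> A" "f (Suc i) \<notin> A" by blast
  show thesis
  proof
    show "{f i, f (Suc i)} \<in> H" using step[OF i(1)] by (simp add: adj_iff)
    show "{f i, f (Suc i)} \<in> near E (Suc n) {p, q}"
      unfolding near_def using circ edges[OF i(1)] pqc len mn
      by (intro UnionI[of "circuit_edges c"] CollectI exI[of _ c]) auto
  qed (use i in auto)
qed

section \<open>Geodesics in a connected simple graph\<close>

locale connected_simple_graph =
  fixes V :: "'v set" and E :: "'v set set"
  assumes simple: "simple_graph V E" and connected: "connected_graph V E"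
begin

abbreviation d :: "'v \<Rightarrow> 'v \<Rightarrow> nat" where "d \<equiv> graph_dist E"

lemma edge_D: "{u, v} \<in> E \<Longrightarrow> u \<in> V \<and> v \<in> V \<and> u \<noteq> v"
  using simple unfolding simple_graph_def by (metis doubleton_eq_iff)

lemma edge_obtain:
  assumes "e \<in> E" obtains u v where "e = {u, v}" "u \<in> V" "v \<in> V" "u \<noteq> v"
  using assms simple unfolding simple_graph_def by metis

lemma walk_dist: "u \<in> V \<Longrightarrow> v \<in> V \<Longrightarrow> (u, v) \<in> adj E ^^ d u v"
  unfolding graph_dist_def
  using connected rtrancl_imp_relpow unfolding connected_graph_def by (metis LeastI)

lemma d_sym: "d u v = d v u"
  unfolding graph_dist_def using adj_relpow_sym by metis

lemma d_refl: "d u u = 0"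
  using graph_dist_le[of u u 0] by simp

lemma d_eq_0: "u \<in> V \<Longrightarrow> v \<in> V \<Longrightarrow> d u v = 0 \<longleftrightarrow> u = v"
  using walk_dist[of u v] d_refl by auto

lemma d_triangle: "u \<in> V \<Longrightarrow> v \<in> V \<Longrightarrow> w \<in> V \<Longrightarrow> d u w \<le> d u v + d v w"
  using relpow_trans[OF walk_dist walk_dist] graph_dist_le by metis

lemma d_edge: "{u, v} \<in> E \<Longrightarrow> d u v = 1"
  using graph_dist_le[of u v 1 E] edge_D[of u v] d_eq_0[of u v] by (auto simp: adj_iff)

text \<open>For \<open>i > 0\<close> the \<open>i\<close>-th vertex has distance at most
  \<open>m - i < m\<close> to \<open>v\<close> and so differs from \<open>s\<close>.\<close>

lemma geodesic_avoids:
  assumes "(u, v) \<in> adj E ^^ m" "s \<noteq> u" "m \<le> d s v"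
  shows "(u, v) \<in> adj {e \<in> E. s \<notin> e} ^^ m"
proof -
  obtain f where f: "f 0 = u" "f m = v" "\<And>i. i < m \<Longrightarrow> (f i, f (Suc i)) \<in> adj E"
    using assms(1) unfolding relpow_fun_conv by auto
  have "f i \<noteq> s" if "i \<le> m" for i
  proof (cases "i = 0")
    case False
    have "(f i, f m) \<in> adj E ^^ (m - i)" by (rule relpow_segment[of m f]) (use f that in auto)
    then have "d (f i) v \<le> m - i" using f graph_dist_le by metis
    then show ?thesis using False that assms(3) by auto
  qed (use f assms in simp)
  then show ?thesis
    unfolding relpow_fun_conv
    using f by (intro exI[of _ f]) (auto simp: adj_iff; metis Suc_leI less_imp_le)
qed

text \<open>This is \<open>geodesic_avoids\<close> with \<open>s = u\<close>: after its first edge a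
  geodesic never returns to its start.\<close>

lemma geodesic_first_edge:
  assumes "u \<in> V" "v \<in> V" "d u v = Suc m"
  obtains y where "{u, y} \<in> E" "(y, v) \<in> adj {e \<in> E. u \<notin> e} ^^ m"
proof -
  obtain y where y: "(u, y) \<in> adj E" "(y, v) \<in> adj E ^^ m"
    using walk_dist[OF assms(1,2)] assms(3) relpow_Suc_D2 by metis
  then have "u \<noteq> y" using edge_D by (auto simp: adj_iff)
  then show thesis
    using that y geodesic_avoids[OF y(2)] assms(3) by (simp add: adj_iff)
qed

lemma geodesic:
  assumes "u \<in> V" "v \<in> V"
  obtains \<gamma> where "\<gamma> 0 = u" "\<gamma> (d u v) = v" "\<And>i. i < d u v \<Longrightarrow> {\<gamma> i, \<gamma> (Suc i)} \<in> E"
    "\<And>i. i \<le> d u v \<Longrightarrow> \<gamma> i \<in> V"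
    "\<And>i j. i \<le> j \<Longrightarrow> j \<le> d u v \<Longrightarrow> d (\<gamma> i) (\<gamma> j) = j - i"
proof -
  obtain f where f: "f 0 = u" "f (d u v) = v" "\<And>i. i < d u v \<Longrightarrow> (f i, f (Suc i)) \<in> adj E"
    using walk_dist[OF assms] unfolding relpow_fun_conv by auto
  have V: "f i \<in> V" if "i \<le> d u v" for i
    using that
  proof (cases i)
    case (Suc j)
    then show ?thesis using f(3)[of j] edge_D that by (auto simp: adj_iff)
  qed (use f assms in auto)
  have seg: "d (f i) (f j) \<le> j - i" if "i \<le> j" "j \<le> d u v" for i j
    using relpow_segment[of "d u v" f] f that by (auto intro: graph_dist_le)
  have "d (f i) (f j) = j - i" if ij: "i \<le> j" "j \<le> d u v" for i j
  proof -
    have "d u v \<le> d u (f j) + d (f j) v" "d u (f j) \<le> d u (f i) + d (f i) (f j)"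
      using assms V ij by (auto intro: d_triangle)
    then show ?thesis
      using seg[of 0 i] seg[of i j] seg[of j "d u v"] f ij by auto
  qed
  then show thesis using that f V by (auto simp: adj_iff)
qed

lemma walk_in_ball:
  assumes "(u, v) \<in> adj E ^^ n" "n \<le> r"
  shows "(u, v) \<in> adj {e \<in> E. e \<subseteq> {z. d u z \<le> r}} ^^ n"
proof -
  obtain f where f: "f 0 = u" "f n = v" "\<And>i. i < n \<Longrightarrow> (f i, f (Suc i)) \<in> adj E"
    using assms(1) unfolding relpow_fun_conv by auto
  have "d u (f i) \<le> r" if "i \<le> n" for i
    using relpow_segment[of n f "adj E" 0 i] f that assms(2) by (auto dest: graph_dist_le)
  then show ?thesis
    unfolding relpow_fun_conv using f by (intro exI[of _ f]) (auto simp: adj_iff)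
qed

text \<open>Once shortened, the walk from \<open>z\<close> to \<open>y\<close> and the two edges at
  \<open>w\<close> form a circuit through both edges, so \<open>{w, y}\<close> is one of the
  finitely many edges near \<open>{w, z}\<close>.\<close>

lemma finite_edges_avoiding:
  assumes fine: "fine_graph E" and e: "{w, z} \<in> E"
  shows "finite {y. {w, y} \<in> E \<and> (z, y) \<in> adj {e \<in> E. w \<notin> e} ^^ n}"
proof (rule finite_subset)
  let ?N = "near E (Suc (Suc n)) {w, z}"
  show "finite (\<Union> ?N)"
    using finite_near[OF fine e] near_subset edge_obtain by (blast intro: finite.intros)
  show "{y. {w, y} \<in> E \<and> (z, y) \<in> adj {e \<in> E. w \<notin> e} ^^ n} \<subseteq> \<Union> ?N"
  proof safe
    fix y assume y: "{w, y} \<in> E" "(z, y) \<in> adj {e \<in> E. w \<notin> e} ^^ n"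
    \<comment> \<open>Only the edge \<open>{w, y}\<close> of \<open>H\<close> meets
      \<open>w\<close>, so the crossing edge for \<open>A = {w}\<close> must be this one.\<close>
    define H where "H = insert {w, y} {e \<in> E. w \<notin> e}"
    have "(y, z) \<in> adj H ^^ n"
      by (rule adj_relpow_mono[OF adj_relpow_sym[OF y(2)]]) (auto simp: H_def)
    moreover have "(w, y) \<in> adj H" by (simp add: adj_iff H_def)
    ultimately have "(w, z) \<in> adj H ^^ Suc n" by (metis relpow_Suc_I2)
    moreover have "H \<subseteq> E" using y by (auto simp: H_def)
    ultimately obtain f where "f \<in> H" "f \<in> ?N" "f \<inter> {w} \<noteq> {}"
      using edge_D[OF e] e by (elim crossing_edge[where A = "{w}"]) auto
    then have "{w, y} \<in> ?N" by (auto simp: H_def)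
    then show "y \<in> \<Union> ?N" by blast
  qed
qed

end

section \<open>Actions with trivial edge stabilisers\<close>

lemma (in group) inj_nat_pow:
  assumes "g \<in> carrier G" "\<And>n::nat. 0 < n \<Longrightarrow> g [^] n \<noteq> \<one>"
  shows "inj (\<lambda>n::nat. g [^] n)"
proof (rule linorder_injI)
  fix m n :: nat assume "m < n"
  then show "g [^] m \<noteq> g [^] n"
    using assms(2)[of "n - m"] pow_eq_div2[OF assms(1), of n m] by auto
qed

lemma (in group) pow_in_subgroup: "subgroup H G \<Longrightarrow> h \<in> H \<Longrightarrow> h [^] (n::nat) \<in> H"
  by (induction n) (auto intro: subgroup.m_closed subgroup.one_closed)

text \<open>Collecting powers of \<open>a\<close> on the left and powers of \<open>b\<close> on the
  right gives an element \<open>u\<close> of both subgroups, which is therefore trivial.\<close>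

lemma (in group) independent_powers:
  assumes H: "subgroup H G" "a \<in> H" "inj (\<lambda>n::nat. a [^] n)"
    and K: "subgroup K G" "b \<in> K" "inj (\<lambda>n::nat. b [^] n)"
    and HK: "H \<inter> K \<subseteq> {\<one>}"
    and eq: "a [^] (i::nat) \<otimes> b [^] (j::nat) = a [^] (k::nat) \<otimes> b [^] (l::nat)"
  shows "i = k \<and> j = l"
proof -
  have c: "a \<in> carrier G" "b \<in> carrier G"
    using subgroup.mem_carrier[OF H(1,2)] subgroup.mem_carrier[OF K(1,2)] by auto
  define u where "u = inv (a [^] k) \<otimes> a [^] i"
  have uH: "u \<in> H"
    unfolding u_def using H(1) pow_in_subgroup[OF H(1,2)]
    by (intro subgroup.m_closed subgroup.m_inv_closed)
  then have uc: "u \<in> carrier G" by (rule subgroup.mem_carrier[OF H(1)])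
  have "u \<otimes> b [^] j = inv (a [^] k) \<otimes> (a [^] k \<otimes> b [^] l)"
    unfolding u_def eq[symmetric] using c by (simp add: m_assoc)
  also have "\<dots> = b [^] l" using c by (simp flip: m_assoc)
  finally have ub: "u \<otimes> b [^] j = b [^] l" .
  then have "u = b [^] l \<otimes> inv (b [^] j)" using c uc by (simp add: inv_solve_right)
  also have "\<dots> \<in> K"
    using K(1) pow_in_subgroup[OF K(1,2)] by (intro subgroup.m_closed subgroup.m_inv_closed)
  finally have u: "u = \<one>" using HK uH by blast
  then have "b [^] j = b [^] l" using ub c by simp
  moreover have "a [^] i = a [^] k"
    using u inv_solve_left[of \<one> "a [^] k" "a [^] i"] c by (simp add: u_def)
  ultimately show ?thesis using injD[OF H(3)] injD[OF K(3)] by blast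
qed

section \<open>Fixed vertices and bounded orbits of a single element\<close>

locale torsion_free_action = connected_simple_graph V E + group G + group_action G V \<phi>
  for V :: "'v set" and E :: "'v set set" and G :: "('g, 'b) monoid_scheme" (structure)
    and \<phi> :: "'g \<Rightarrow> 'v \<Rightarrow> 'v" +
  assumes fine: "fine_graph E"
    and edge_closed: "\<And>g e. g \<in> carrier G \<Longrightarrow> e \<in> E \<Longrightarrow> \<phi> g ` e \<in> E"
    and finite_edge_stabilizer: "\<And>e. e \<in> E \<Longrightarrow> finite (stabilizer G (edge_action \<phi>) e)"
    and torsion_free: "\<And>g n. g \<in> carrier G \<Longrightarrow> g [^] (n::nat) = \<one> \<Longrightarrow> 0 < n \<Longrightarrow> g = \<one>"
begin

lemma act_closed: "g \<in> carrier G \<Longrightarrow> v \<in> V \<Longrightarrow> \<phi> g v \<in> V"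
  using element_image by blast

lemma act_one: "v \<in> V \<Longrightarrow> \<phi> \<one> v = v"
  using id_eq_one by (metis restrict_apply')

lemma act_inv: "g \<in> carrier G \<Longrightarrow> v \<in> V \<Longrightarrow> \<phi> (inv g) (\<phi> g v) = v"
  using orbit_sym_aux by blast

lemma act_inv': "g \<in> carrier G \<Longrightarrow> v \<in> V \<Longrightarrow> \<phi> g (\<phi> (inv g) v) = v"
  using act_inv[of "inv g" v] by simp

lemma act_inj: "g \<in> carrier G \<Longrightarrow> u \<in> V \<Longrightarrow> v \<in> V \<Longrightarrow> \<phi> g u = \<phi> g v \<longleftrightarrow> u = v"
  using inj_prop by (meson inj_on_eq_iff)

lemma act_pow_add:
  "g \<in> carrier G \<Longrightarrow> v \<in> V \<Longrightarrow> \<phi> (g [^] (m + n :: nat)) v = \<phi> (g [^] m) (\<phi> (g [^] n) v)"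
  by (simp add: composition_rule flip: nat_pow_mult)

lemma act_pow_Suc:
  "g \<in> carrier G \<Longrightarrow> v \<in> V \<Longrightarrow> \<phi> (g [^] Suc n) v = \<phi> g (\<phi> (g [^] n) v)"
  using act_pow_add[of g v 1 n] by simp

lemma act_pow_commute:
  assumes "g \<in> carrier G" "v \<in> V"
  shows "\<phi> (g [^] (n::nat)) (\<phi> g v) = \<phi> g (\<phi> (g [^] n) v)"
  unfolding act_pow_Suc[OF assms, symmetric] using assms by (simp add: composition_rule)

lemma act_pow_fixed: "g \<in> carrier G \<Longrightarrow> v \<in> V \<Longrightarrow> \<phi> g v = v \<Longrightarrow> \<phi> (g [^] (n::nat)) v = v"
  by (induction n) (simp_all add: act_one composition_rule)

lemma act_pow_eq:
  assumes "g \<in> carrier G" "v \<in> V" "\<phi> (g [^] i) v = \<phi> (g [^] j) v" "i < (j::nat)"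
  shows "\<phi> (g [^] (j - i)) v = v"
proof -
  have "\<phi> (g [^] i) (\<phi> (g [^] (j - i)) v) = \<phi> (g [^] i) v"
    using assms act_pow_add[of g v i "j - i"] by simp
  then show ?thesis
    using act_inj[of "g [^] i" "\<phi> (g [^] (j - i)) v" v] assms(1,2) act_closed by blast
qed

lemma pow_ne_one: "g \<in> carrier G \<Longrightarrow> g \<noteq> \<one> \<Longrightarrow> 0 < n \<Longrightarrow> g [^] (n::nat) \<noteq> \<one>"
  using torsion_free by blast

lemma infinite_order: "g \<in> carrier G \<Longrightarrow> g \<noteq> \<one> \<Longrightarrow> inj (\<lambda>n::nat. g [^] n)"
  by (rule inj_nat_pow) (auto dest: pow_ne_one)

text \<open>All powers of \<open>g\<close> preserve \<open>e\<close>. They are pairwise distinct if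
  \<open>g\<close> is nontrivial, but the stabiliser is finite.\<close>

lemma edge_stabilizer_trivial:
  assumes e: "e \<in> E" and g: "g \<in> carrier G" "\<phi> g ` e = e"
  shows "g = \<one>"
proof (rule ccontr)
  assume "g \<noteq> \<one>"
  have eV: "e \<subseteq> V" using e edge_obtain by blast
  have "\<phi> (g [^] n) ` e = e" for n :: nat
  proof (induction n)
    case 0
    then show ?case using eV act_one by force
  next
    case (Suc n)
    have "\<phi> (g [^] Suc n) ` e = \<phi> g ` (\<phi> (g [^] n) ` e)"
      unfolding image_image using eV g act_pow_Suc[of g] by (intro image_cong) auto
    then show ?case using Suc g by simp
  qed
  then have "range (\<lambda>n::nat. g [^] n) \<subseteq> stabilizer G (edge_action \<phi>) e"
    using g by (auto simp: stabilizer_def edge_action_def)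
  then have "finite (range (\<lambda>n::nat. g [^] n))"
    using finite_edge_stabilizer[OF e] finite_subset by blast
  then show False using infinite_order[OF g(1) \<open>g \<noteq> \<one>\<close>] finite_imageD by blast
qed

lemma act_edge: "g \<in> carrier G \<Longrightarrow> {u, v} \<in> E \<Longrightarrow> {\<phi> g u, \<phi> g v} \<in> E"
  using edge_closed[of g "{u, v}"] by simp

lemma act_walk: "g \<in> carrier G \<Longrightarrow> (u, v) \<in> adj E ^^ n \<Longrightarrow> (\<phi> g u, \<phi> g v) \<in> adj E ^^ n"
  by (erule relpow_map) (auto simp: adj_iff act_edge)

lemma act_walk_avoiding:
  assumes "g \<in> carrier G" "w \<in> V" "(u, v) \<in> adj {e \<in> E. w \<notin> e} ^^ n"
  shows "(\<phi> g u, \<phi> g v) \<in> adj {e \<in> E. \<phi> g w \<notin> e} ^^ n"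
  using assms(3)
  by (rule relpow_map) (use assms(1,2) edge_D in \<open>auto simp: adj_iff act_edge act_inj\<close>)

lemma d_act:
  assumes g: "g \<in> carrier G" and uv: "u \<in> V" "v \<in> V"
  shows "d (\<phi> g u) (\<phi> g v) = d u v"
proof -
  have le: "d (\<phi> h s) (\<phi> h t) \<le> d s t" if "h \<in> carrier G" "s \<in> V" "t \<in> V" for h s t
    using that by (intro graph_dist_le act_walk walk_dist)
  have "d u v \<le> d (\<phi> g u) (\<phi> g v)"
    using le[of "inv g" "\<phi> g u" "\<phi> g v"] assms by (simp add: act_inv act_closed)
  with le[OF assms] show ?thesis by simp
qed

text \<open>The powers of \<open>g\<close> carry the first edge \<open>{u, y}\<close> of a geodesic
  from \<open>u\<close> to \<open>v\<close> to edges at \<open>u\<close>. Their other ends are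
  linked through \<open>v\<close> by walks avoiding \<open>u\<close>, so fineness leaves finitely
  many of them, and some nontrivial power fixes the edge.\<close>

lemma fixed_vertex_unique:
  assumes g: "g \<in> carrier G" "g \<noteq> \<one>" and uv: "u \<in> V" "v \<in> V" "\<phi> g u = u" "\<phi> g v = v"
  shows "u = v"
proof (rule ccontr)
  assume "u \<noteq> v"
  then obtain m where m: "d u v = Suc m" using d_eq_0[OF uv(1,2)] by (cases "d u v") auto
  then obtain y where y: "{u, y} \<in> E" "(y, v) \<in> adj {e \<in> E. u \<notin> e} ^^ m"
    by (rule geodesic_first_edge[OF uv(1,2)])
  have yV: "y \<in> V" using y edge_D by blast
  \<comment> \<open>From \<open>y\<close> to the fixed \<open>v\<close> along the tail of the
    geodesic and back along its translate: hence the length \<open>m + m\<close>.\<close>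
  let ?Y = "{z. {u, z} \<in> E \<and> (y, z) \<in> adj {e \<in> E. u \<notin> e} ^^ (m + m)}"
  have "\<phi> (g [^] k) y \<in> ?Y" for k :: nat
  proof -
    have gk: "g [^] k \<in> carrier G" using g by simp
    have fix_u: "\<phi> (g [^] k) u = u" and fix_v: "\<phi> (g [^] k) v = v"
      by (rule act_pow_fixed[OF g(1) uv(1,3)], rule act_pow_fixed[OF g(1) uv(2,4)])
    have "(\<phi> (g [^] k) y, v) \<in> adj {e \<in> E. u \<notin> e} ^^ m"
      using act_walk_avoiding[OF gk uv(1) y(2)] unfolding fix_u fix_v .
    then have "(y, \<phi> (g [^] k) y) \<in> adj {e \<in> E. u \<notin> e} ^^ (m + m)"
      by (rule relpow_trans[OF y(2) adj_relpow_sym])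
    moreover have "{u, \<phi> (g [^] k) y} \<in> E" using act_edge[OF gk y(1)] unfolding fix_u .
    ultimately show ?thesis by simp
  qed
  then have "range (\<lambda>k::nat. \<phi> (g [^] k) y) \<subseteq> ?Y" by (rule image_subsetI)
  then have "finite (range (\<lambda>k::nat. \<phi> (g [^] k) y))"
    by (rule finite_subset[OF _ finite_edges_avoiding[OF fine y(1)]])
  then have "\<not> inj (\<lambda>k::nat. \<phi> (g [^] k) y)" by (auto dest: finite_imageD)
  then have "\<exists>i j::nat. i < j \<and> \<phi> (g [^] i) y = \<phi> (g [^] j) y"
    by (rule contrapos_np) (auto intro: linorder_injI)
  then obtain i j :: nat where "i < j" "\<phi> (g [^] i) y = \<phi> (g [^] j) y" by blast
  then have j: "0 < j - i" "\<phi> (g [^] (j - i)) y = y" using act_pow_eq[OF g(1) yV] by auto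
  then have "\<phi> (g [^] (j - i)) ` {u, y} = {u, y}"
    by (simp add: act_pow_fixed[OF g(1) uv(1,3)])
  then have "g [^] (j - i) = \<one>"
    by (rule edge_stabilizer_trivial[OF y(1), rotated]) (use g in simp)
  then show False using pow_ne_one[OF g j(1)] by blast
qed

text \<open>The vertex \<open>\<phi> g w\<close> is fixed by \<open>g [^] n\<close> as well, and a
  nontrivial element fixes at most one vertex.\<close>

lemma power_fixed_imp_fixed:
  assumes "g \<in> carrier G" "g \<noteq> \<one>" "w \<in> V" "0 < (n::nat)" "\<phi> (g [^] n) w = w"
  shows "\<phi> g w = w"
proof -
  have "\<phi> (g [^] n) (\<phi> g w) = \<phi> g w"
    using act_pow_commute[of g w n] assms by simp
  then show ?thesis
    using fixed_vertex_unique[OF _ pow_ne_one[OF assms(1,2,4)] act_closed[OF assms(1,3)] assms(3)]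
      assms by simp
qed

text \<open>There is at most one such \<open>k\<close>: two visits would make a power of
  \<open>g\<close> fix \<open>z\<close>. Then \<open>g\<close> itself fixes \<open>z\<close>, the
  orbit is constant and \<open>z = w\<close>, although \<open>g\<close> moves
  \<open>w\<close>.\<close>

lemma finite_visits:
  assumes "g \<in> carrier G" "g \<noteq> \<one>" "w \<in> V" "\<phi> g w \<noteq> w" "z \<in> V"
  shows "finite {k::nat. \<phi> (g [^] k) z = w}"
proof -
  have neq: False if "i < j" "\<phi> (g [^] i) z = w" "\<phi> (g [^] j) z = w" for i j :: nat
  proof -
    have "\<phi> (g [^] (j - i)) z = z"
      by (rule act_pow_eq[OF assms(1,5) _ that(1)]) (simp only: that)
    then have fix_z: "\<phi> g z = z"
      by (rule power_fixed_imp_fixed[OF assms(1,2,5), rotated]) (use that in simp)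
    then have "z = w" using act_pow_fixed[OF assms(1,5) fix_z, of i] that(2) by (simp only:)
    then show False using fix_z assms(4) by blast
  qed
  have *: "k = l" if "\<phi> (g [^] k) z = w" "\<phi> (g [^] l) z = w" for k l :: nat
    using that neq[of k l] neq[of l k] by (cases k l rule: linorder_cases) blast+
  show ?thesis
  proof (cases "\<exists>k::nat. \<phi> (g [^] k) z = w")
    case True
    then obtain k :: nat where "\<phi> (g [^] k) z = w" by blast
    then have "{k::nat. \<phi> (g [^] k) z = w} \<subseteq> {k}" using * by blast
    then show ?thesis using finite_subset by blast
  qed simp
qed

text \<open>
  Let \<open>w\<close> be a vertex with infinitely many orbit points at the least possible distance \<open>m\<close>. By
  minimality infinitely many edges at \<open>w\<close> start a geodesic to an orbit point. If \<open>g\<close> moved \<open>w\<close>,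
  then all of these could be joined, by walks of bounded length avoiding \<open>w\<close>, to the image of
  \<open>w\<close> under \<open>g\<close>, contradicting fineness.
\<close>

lemma bounded_orbit_imp_fixed:
  assumes g: "g \<in> carrier G" "g \<noteq> \<one>" and x: "x \<in> V"
    and bounded: "\<And>k::nat. d x (\<phi> (g [^] k) x) \<le> R"
  shows "\<exists>w\<in>V. \<phi> g w = w"
proof -
  define X where "X k = \<phi> (g [^] k) x" for k :: nat
  define P where "P m \<longleftrightarrow> (\<exists>w\<in>V. infinite {k. d w (X k) \<le> m})" for m
  define m where "m = (LEAST m. P m)"
  have XV: "X k \<in> V" for k unfolding X_def using g x act_closed by simp
  have "P R" unfolding P_def using bounded x by (auto simp: X_def intro!: bexI[of _ x])
  then have "P m" unfolding m_def by (rule LeastI)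
  then obtain w where w: "w \<in> V" "infinite {k. d w (X k) \<le> m}" unfolding P_def by blast
  \<comment> \<open>By minimality of \<open>m\<close>, only finitely many exponents bring the orbit
    closer than \<open>m\<close> to a given vertex.\<close>
  have fin: "finite {k. d s (X k) < m}" if "s \<in> V" for s
  proof (cases m)
    case (Suc l)
    then have "\<not> P l" unfolding m_def using not_less_Least[of l P] by auto
    then show ?thesis using that Suc by (auto simp: P_def less_Suc_eq_le)
  qed simp
  have "\<phi> g w = w"
  proof (rule ccontr)
    assume neq: "\<phi> g w \<noteq> w"
    define w' where "w' = \<phi> (inv g) w"
    have w': "w' \<in> V" "\<phi> g w' = w" unfolding w'_def using g w by (auto simp: act_closed act_inv')
    with neq have ww': "w' \<noteq> w" by auto
    \<comment> \<open>If \<open>m = 0\<close>, the orbit would visit \<open>w\<close> infinitely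
      often, contrary to \<open>finite_visits\<close>.\<close>
    obtain l where l: "m = Suc l"
    proof (cases m)
      case 0
      then have "{k. d w (X k) \<le> m} = {k. \<phi> (g [^] k) x = w}"
        using d_eq_0[OF w(1) XV] by (auto simp: X_def)
      then show ?thesis using finite_visits[OF g w(1) neq x] w by simp
    qed
    define D where "D = d x (\<phi> g x)"
    obtain f where f: "f 0 = x" "f D = \<phi> g x" "\<And>i. i < D \<Longrightarrow> {f i, f (Suc i)} \<in> E"
      "\<And>i. i \<le> D \<Longrightarrow> f i \<in> V"
      using geodesic[OF x act_closed[OF g(1) x]] unfolding D_def by metis
    define H where "H = {e \<in> E. w \<notin> e}"
    \<comment> \<open>Discarded exponents: the orbit point is too close to \<open>w\<close> or to
      \<open>w'\<close>, or the translated path from it to its image under \<open>g\<close> meets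
      \<open>w\<close>.\<close>
    define bad where "bad = {k. d w (X k) < m} \<union> {k. d w' (X k) < m} \<union>
       (\<Union>i\<le>D. {k. \<phi> (g [^] k) (f i) = w})"
    have "finite bad"
      unfolding bad_def using fin w(1) w'(1) finite_visits[OF g w(1) neq] f by auto
    define K where "K = {k. d w (X k) \<le> m} - bad"
    have infK: "infinite K" unfolding K_def using w \<open>finite bad\<close> by (rule_tac Diff_infinite_finite)
    have "\<exists>y. {w, y} \<in> E \<and> (y, X k) \<in> adj H ^^ l" if "k \<in> K" for k
    proof -
      have "d w (X k) = Suc l" using that l by (auto simp: K_def bad_def)
      then show ?thesis using geodesic_first_edge[OF w(1) XV] unfolding H_def by metis
    qed
    then obtain y where y: "\<And>k. k \<in> K \<Longrightarrow> {w, y k} \<in> E" "\<And>k. k \<in> K \<Longrightarrow> (y k, X k) \<in> adj H ^^ l"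
      by metis
    \<comment> \<open>The walk runs from \<open>y k\<close> to \<open>X k\<close>, along the
      translated path to \<open>\<phi> g (X k)\<close>, and on to \<open>\<phi> g w\<close>; no part
      of it meets \<open>w\<close>.\<close>
    have far: "(y k, \<phi> g w) \<in> adj H ^^ (l + (D + m))" if k: "k \<in> K" for k
    proof -
      have step: "{\<phi> (g [^] k) (f i), \<phi> (g [^] k) (f (Suc i))} \<in> H" if "i < D" for i
        using act_edge[of "g [^] k"] f(3)[OF that] g k that unfolding H_def K_def bad_def
        by (auto simp: Suc_le_eq)
      have "\<phi> (g [^] k) (\<phi> g x) = \<phi> g (X k)"
        using act_pow_commute[OF g(1) x] by (simp add: X_def)
      then have "(X k, \<phi> g (X k)) \<in> adj H ^^ D"
        unfolding relpow_fun_conv using f step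
        by (intro exI[of _ "\<lambda>i. \<phi> (g [^] k) (f i)"]) (auto simp: X_def adj_iff)
      \<comment> \<open>The geodesic from \<open>w\<close> to \<open>X k\<close> avoids
        \<open>w'\<close>, so its image under \<open>g\<close> avoids \<open>w\<close>.\<close>
      moreover have "(\<phi> g (X k), \<phi> g w) \<in> adj H ^^ m"
      proof -
        have "d w (X k) = m" "m \<le> d w' (X k)" using k by (auto simp: K_def bad_def)
        then have "(w, X k) \<in> adj {e \<in> E. w' \<notin> e} ^^ m"
          using geodesic_avoids[OF _ ww'] walk_dist[OF w(1) XV] by metis
        then have "(\<phi> g w, \<phi> g (X k)) \<in> adj H ^^ m"
          using act_walk_avoiding[OF g(1) w'(1)] unfolding H_def w' by blast
        then show ?thesis by (rule adj_relpow_sym)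
      qed
      ultimately show ?thesis using y(2)[OF k] by (intro relpow_trans)
    qed
    obtain k0 where k0: "k0 \<in> K" using infK by (metis ex_in_conv finite.emptyI)
    define N where "N = l + (D + m) + (l + (D + m))"
    define Y where "Y = {z. {w, z} \<in> E \<and> (y k0, z) \<in> adj H ^^ N}"
    have "finite Y"
      unfolding Y_def H_def using finite_edges_avoiding[OF fine y(1)[OF k0]] .
    \<comment> \<open>Each of the finitely many \<open>z\<close> in \<open>Y\<close> is within
      \<open>l < m\<close> of \<open>X k\<close> for finitely many \<open>k\<close> only, so these
      cannot exhaust the infinite set \<open>K\<close>.\<close>
    have "K \<subseteq> (\<Union>z\<in>Y. {k. d z (X k) < m})"
    proof
      fix k assume k: "k \<in> K"
      have "(y k0, y k) \<in> adj H ^^ N"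
        unfolding N_def by (rule relpow_trans[OF far[OF k0] adj_relpow_sym[OF far[OF k]]])
      then have "y k \<in> Y" using y k by (simp add: Y_def)
      moreover have "(y k, X k) \<in> adj E ^^ l"
        using y(2)[OF k] by (rule adj_relpow_mono) (auto simp: H_def)
      then have "d (y k) (X k) < m" using l graph_dist_le by (metis less_Suc_eq_le)
      ultimately show "k \<in> (\<Union>z\<in>Y. {k. d z (X k) < m})" by blast
    qed
    moreover have "finite (\<Union>z\<in>Y. {k. d z (X k) < m})"
      using \<open>finite Y\<close> fin edge_D by (auto simp: Y_def)
    ultimately show False using infK finite_subset by blast
  qed
  with w show ?thesis by blast
qed

end

section \<open>Hyperbolicity\<close>

context connected_simple_graph
begin

text \<open>Gromov's inequality for vertices, cleared of denominators (hence
  \<open>2 * \<delta>\<close>) and with a natural constant, so that the later estimates are linear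
  arithmetic.\<close>

definition four_point :: "nat \<Rightarrow> bool" where
  "four_point \<delta> \<longleftrightarrow> (\<forall>w\<in>V. \<forall>x\<in>V. \<forall>y\<in>V. \<forall>z\<in>V.
     d x z + d w y \<le> max (d x y + d w z) (d y z + d x w) + 2 * \<delta>)"

lemma incident_edge:
  assumes "E \<noteq> {}" "v \<in> V"
  obtains u where "{v, u} \<in> E"
proof -
  obtain c where c: "c \<in> V" "c \<noteq> v" using assms(1) edge_obtain by (metis ex_in_conv)
  then obtain m where m: "d v c = Suc m" using d_eq_0[of v c] assms(2) by (cases "d v c") auto
  show thesis using geodesic_first_edge[OF assms(2) c(1) m] that by blast
qed

text \<open>A vertex is the point with parameter 0 on any incident edge. By the triangle inequality,
  routes through the other endpoints are no shorter than \<open>d u a\<close>.\<close>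

lemma realization_dist_vertices:
  assumes "{u, u'} \<in> E" "{a, a'} \<in> E"
  shows "realization_dist E (u, u', 0) (a, a', 0) = real (d u a)"
proof -
  have V: "u \<in> V" "u' \<in> V" "a \<in> V" "a' \<in> V" using assms edge_D by auto
  have 1: "d u u' = 1" "d a' a = 1" using assms d_edge d_sym by metis+
  have "d u a \<le> d u a' + 1" "d u a \<le> 1 + d u' a" "d u' a \<le> d u' a' + 1"
    using V d_triangle[of u a' a] d_triangle[of u u' a] d_triangle[of u' a' a] 1 by auto
  then show ?thesis
    using 1 by (auto simp: realization_dist_def d_refl d_sym min_def)
qed

lemma gromov_hyperbolic_imp_four_point:
  assumes hyp: "gromov_hyperbolic (edge_points E) (realization_dist E)" and E: "E \<noteq> {}"
  obtains \<delta> where "four_point \<delta>"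
proof -
  obtain r where r: "\<And>w x y z. \<lbrakk>w \<in> edge_points E; x \<in> edge_points E; y \<in> edge_points E;
      z \<in> edge_points E\<rbrakk> \<Longrightarrow> gromov_product (realization_dist E) w x z \<ge>
        min (gromov_product (realization_dist E) w x y) (gromov_product (realization_dist E) w y z) - r"
    using hyp unfolding gromov_hyperbolic_def by blast
  define \<delta> where "\<delta> = nat \<lceil>r\<rceil>"
  have \<delta>: "r \<le> real \<delta>" unfolding \<delta>_def by linarith
  \<comment> \<open>One chosen edge at each vertex turns vertices into points of the
    realization.\<close>
  obtain s where s: "\<And>v. v \<in> V \<Longrightarrow> {v, s v} \<in> E"
  proof -
    have "\<forall>v\<in>V. \<exists>u. {v, u} \<in> E" using incident_edge[OF E] by blast
    then show thesis using that by (metis bchoice)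
  qed
  have "four_point \<delta>"
    unfolding four_point_def
  proof (intro ballI)
    fix w x y z assume V: "w \<in> V" "x \<in> V" "y \<in> V" "z \<in> V"
    have pt: "(v, s v, 0) \<in> edge_points E" if "v \<in> V" for v
      using s[OF that] by (simp add: edge_points_def)
    have rd: "realization_dist E (u, s u, 0) (v, s v, 0) = real (d u v)" if "u \<in> V" "v \<in> V" for u v
      using realization_dist_vertices s that by blast
    have "(real (d x w) + real (d z w) - real (d x z)) / 2 \<ge>
        min ((real (d x w) + real (d y w) - real (d x y)) / 2)
          ((real (d y w) + real (d z w) - real (d y z)) / 2) - r"
      using r[OF pt pt pt pt, OF V] V by (simp add: gromov_product_def rd)
    then have "real (d x z) + real (d y w) \<le> real (d x y) + real (d z w) + 2 * real \<delta> \<or>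
        real (d x z) + real (d y w) \<le> real (d y z) + real (d x w) + 2 * real \<delta>"
      using \<delta> by (auto simp: min_def field_simps split: if_splits)
    then have "d x z + d y w \<le> d x y + d z w + 2 * \<delta> \<or> d x z + d y w \<le> d y z + d x w + 2 * \<delta>"
      by linarith
    then show "d x z + d w y \<le> max (d x y + d w z) (d y z + d x w) + 2 * \<delta>"
      using d_sym[of w y] d_sym[of w z] by linarith
  qed
  then show thesis by (rule that)
qed

text \<open>The four-point condition is used three times, at a cost of \<open>2 * \<delta>\<close>
  each: to replace \<open>x\<close> by \<open>x'\<close>, to replace \<open>y\<close> by
  \<open>y'\<close> (both times the distance of \<open>p\<close> from the ends excludes one
  alternative), and to compare \<open>p\<close> with a point of the new geodesic.\<close>

lemma near_perturbed_geodesic: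
  assumes hyp: "four_point \<delta>"
    and V: "x \<in> V" "y \<in> V" "x' \<in> V" "y' \<in> V" "p \<in> V"
    and p: "d x p + d p y = d x y" "R + 2 * \<delta> < d x p" "R + 2 * \<delta> < d p y"
    and R: "d x x' \<le> R" "d y y' \<le> R"
    and \<gamma>: "\<gamma> 0 = x'" "\<gamma> (d x' y') = y'" "\<And>i. i \<le> d x' y' \<Longrightarrow> \<gamma> i \<in> V"
      "\<And>i j. i \<le> j \<Longrightarrow> j \<le> d x' y' \<Longrightarrow> d (\<gamma> i) (\<gamma> j) = j - i"
  obtains j where "j \<le> d x' y'" "d p (\<gamma> j) \<le> 6 * \<delta>"
proof -
  have H: "d x z + d w y \<le> d x y + d w z + 2 * \<delta> \<or> d x z + d w y \<le> d y z + d x w + 2 * \<delta>"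
    if "w \<in> V" "x \<in> V" "y \<in> V" "z \<in> V" for w x y z
    using hyp that unfolding four_point_def by (fastforce simp: max_def split: if_splits)
  have tri: "d x p \<le> d x x' + d x' p" "d y p \<le> d y y' + d y' p" "d x' y' \<le> d x' p + d p y'"
    using V by (auto intro: d_triangle)
  note sym = d_sym[of x' p] d_sym[of y' p] d_sym[of y p] d_sym[of x' y] d_sym[of p x] d_sym[of y' y]
  have 1: "d p x' + d p y \<le> d x' y + 2 * \<delta>"
    using H[of x p y x'] V p R tri sym by linarith
  have 2: "d p y' + d p x' \<le> d x' y' + 4 * \<delta>"
    using H[of x' p y y'] V p R tri sym 1 by linarith
  \<comment> \<open>The position at the same distance from \<open>x'\<close> as \<open>p\<close>;
    the minimum is taken because \<open>p\<close> may be farther from \<open>x'\<close> than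
    \<open>y'\<close> is.\<close>
  define t where "t = min (d x' p) (d x' y')"
  have t: "t \<le> d x' y'" unfolding t_def by simp
  have z: "\<gamma> t \<in> V" "d x' (\<gamma> t) = t" "d (\<gamma> t) y' = d x' y' - t"
    using \<gamma>(3)[OF t] \<gamma>(4)[OF _ t, of 0] \<gamma>(4)[OF t] \<gamma>(1,2) by auto
  have "d p (\<gamma> t) + d x' y' \<le> d p y' + t + 2 * \<delta> \<or>
      d p (\<gamma> t) + d x' y' \<le> d x' y' - t + d p x' + 2 * \<delta>"
    using H[of x' p y' "\<gamma> t"] V z d_sym[of "\<gamma> t" y'] by metis
  then have "d p (\<gamma> t) \<le> 6 * \<delta>"
    using 2 tri(3) sym unfolding t_def by linarith
  then show thesis using that t by blast
qed

end

section \<open>Uniform fineness and translated geodesics\<close>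

lemma near_mono: "m \<le> n \<Longrightarrow> near E m e \<subseteq> near E n e"
  unfolding near_def by fastforce

context torsion_free_action
begin

lemma act_near:
  assumes g: "g \<in> carrier G" and f: "f \<in> near E n e"
  shows "\<phi> g ` f \<in> near E n (\<phi> g ` e)"
proof -
  obtain c where c: "circuit E c" "length c \<le> n" "e \<in> circuit_edges c" "f \<in> circuit_edges c"
    using f unfolding near_def by blast
  have ce: "circuit_edges b = (\<lambda>i. {b ! i, b ! (Suc i mod length b)}) ` {..<length b}"
    for b :: "'v list" by (auto simp: circuit_edges_def)
  have "circuit_edges (map (\<phi> g) c) =
      (\<lambda>i. {map (\<phi> g) c ! i, map (\<phi> g) c ! (Suc i mod length c)}) ` {..<length c}"
    unfolding ce by simp
  also have "\<dots> = (\<lambda>i. \<phi> g ` {c ! i, c ! (Suc i mod length c)}) ` {..<length c}"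
  proof (intro image_cong refl)
    fix i assume "i \<in> {..<length c}"
    then have "i < length c" "Suc i mod length c < length c"
      by (auto intro!: mod_less_divisor)
    then show "{map (\<phi> g) c ! i, map (\<phi> g) c ! (Suc i mod length c)} =
        \<phi> g ` {c ! i, c ! (Suc i mod length c)}" by simp
  qed
  also have "\<dots> = (`) (\<phi> g) ` circuit_edges c" unfolding ce image_image ..
  finally have edges: "circuit_edges (map (\<phi> g) c) = (`) (\<phi> g) ` circuit_edges c" .
  have "set c \<subseteq> V"
  proof
    fix z assume "z \<in> set c"
    then obtain i where i: "i < length c" "z = c ! i" by (metis in_set_conv_nth)
    then have "{z, c ! (Suc i mod length c)} \<in> E"
      using c(1) unfolding circuit_def circuit_edges_def by blast
    then show "z \<in> V" using edge_D by blast
  qed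
  then have "distinct (map (\<phi> g) c)"
    using c(1) inj_prop[OF g] by (auto simp: circuit_def distinct_map intro: inj_on_subset)
  moreover have "circuit_edges (map (\<phi> g) c) \<subseteq> E"
    using c(1) edge_closed[OF g] by (auto simp: edges circuit_def)
  ultimately have "circuit E (map (\<phi> g) c)" by (simp add: circuit_def)
  then show ?thesis
    unfolding near_def using c
    by (intro UnionI[of "circuit_edges (map (\<phi> g) c)"] CollectI exI[of _ "map (\<phi> g) c"])
      (auto simp: edges)
qed

lemma act_mult_edge:
  assumes "g \<in> carrier G" "h \<in> carrier G" "e \<in> E"
  shows "\<phi> (g \<otimes> h) ` e = \<phi> g ` \<phi> h ` e"
proof -
  have "e \<subseteq> V" using assms(3) edge_obtain by blast
  then show ?thesis unfolding image_image using assms composition_rule by (intro image_cong) auto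
qed

lemma act_one_edge: "e \<in> E \<Longrightarrow> \<phi> \<one> ` e = e"
  by (elim edge_obtain) (simp add: act_one)

text \<open>Allows an element to be recovered from the image of a single edge, which makes the later
  counting map injective.\<close>

lemma act_edge_cancel:
  assumes "g \<in> carrier G" "h \<in> carrier G" "e \<in> E" "\<phi> g ` e = \<phi> h ` e"
  shows "g = h"
proof -
  have "\<phi> (inv h \<otimes> g) ` e = \<phi> (inv h \<otimes> h) ` e"
    using act_mult_edge[OF inv_closed[OF assms(2)] assms(1,3)]
      act_mult_edge[OF inv_closed[OF assms(2)] assms(2,3)] assms(4) by simp
  also have "\<dots> = e" using act_one_edge[OF assms(3)] assms(2) by simp
  finally have "inv h \<otimes> g = \<one>"
    by (rule edge_stabilizer_trivial[OF assms(3) m_closed[OF inv_closed[OF assms(2)] assms(1)]])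
  then have "h \<otimes> (inv h \<otimes> g) = h" using assms(2) by simp
  then show ?thesis using assms(1,2) by (simp add: m_assoc[symmetric])
qed

lemma edge_representatives:
  assumes fin: "finite (orbits G E (edge_action \<phi>))"
  obtains C where "finite C" "C \<subseteq> E" "\<forall>e\<in>E. \<exists>h\<in>carrier G. \<exists>e0\<in>C. e = \<phi> h ` e0"
proof -
  have "orbits G E (edge_action \<phi>) \<subseteq> orbit G (edge_action \<phi>) ` E"
    by (auto simp: orbits_def)
  from finite_subset_image[OF fin this] obtain C
    where C: "C \<subseteq> E" "finite C" "orbits G E (edge_action \<phi>) = orbit G (edge_action \<phi>) ` C"
    by blast
  have "\<exists>h\<in>carrier G. \<exists>e0\<in>C. e = \<phi> h ` e0" if e: "e \<in> E" for e
  proof -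
    have "orbit G (edge_action \<phi>) e \<in> orbits G E (edge_action \<phi>)"
      unfolding orbits_def using e by blast
    then obtain e0 where e0: "e0 \<in> C" "orbit G (edge_action \<phi>) e = orbit G (edge_action \<phi>) e0"
      unfolding C(3) by blast
    have "edge_action \<phi> \<one> e = e" using act_one_edge[OF e] by (simp add: edge_action_def)
    then have "e \<in> orbit G (edge_action \<phi>) e"
      unfolding orbit_def by (intro CollectI exI[of _ \<one>]) simp
    then have "e \<in> orbit G (edge_action \<phi>) e0" unfolding e0(2) .
    then obtain h where "h \<in> carrier G" "e = \<phi> h ` e0"
      unfolding orbit_def edge_action_def by (elim CollectE exE conjE) (rule that)
    then show ?thesis using e0(1) by (intro bexI)
  qed
  then have "\<forall>e\<in>E. \<exists>h\<in>carrier G. \<exists>e0\<in>C. e = \<phi> h ` e0" by (rule ballI)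
  with C(2,1) show thesis by (rule that)
qed

text \<open>Every edge is a translate of one of finitely many representatives, and
  \<open>near\<close> is equivariant; so fineness becomes uniform.\<close>

lemma card_near_bounded:
  assumes fin: "finite (orbits G E (edge_action \<phi>))"
  obtains M where "\<And>e. e \<in> E \<Longrightarrow> card (near E n e) \<le> M"
proof -
  obtain C where C: "finite C" "C \<subseteq> E" "\<forall>e\<in>E. \<exists>h\<in>carrier G. \<exists>e0\<in>C. e = \<phi> h ` e0"
    by (rule edge_representatives[OF fin])
  have "card (near E n e) \<le> (\<Sum>e\<in>C. card (near E n e))" if e: "e \<in> E" for e
  proof -
    obtain h e0 where h: "h \<in> carrier G" "e = \<phi> h ` e0" and e0: "e0 \<in> C"
      using bspec[OF C(3) e] by (elim bexE) (rule that)
    have e0E: "e0 \<in> E" using e0 C by blast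
    have "near E n e \<subseteq> (`) (\<phi> h) ` near E n e0"
    proof
      fix f assume f: "f \<in> near E n e"
      then have fE: "f \<in> E" using near_subset by blast
      have "\<phi> (inv h) ` e = e0"
        using act_mult_edge[OF inv_closed[OF h(1)] h(1) e0E] act_one_edge[OF e0E]
        unfolding h(2) l_inv[OF h(1)] by (rule trans[OF sym])
      then have "\<phi> (inv h) ` f \<in> near E n e0"
        using act_near[OF inv_closed[OF h(1)] f] by simp
      moreover have "f = \<phi> h ` \<phi> (inv h) ` f"
        using act_mult_edge[OF h(1) inv_closed[OF h(1)] fE] act_one_edge[OF fE]
        unfolding r_inv[OF h(1)] by (rule trans[OF sym, THEN sym])
      ultimately show "f \<in> (`) (\<phi> h) ` near E n e0" by (rule rev_image_eqI)
    qed
    then have "card (near E n e) \<le> card (near E n e0)"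
      by (rule surj_card_le[OF finite_near[OF fine e0E]])
    also have "\<dots> \<le> (\<Sum>e\<in>C. card (near E n e))"
      using e0 C(1) by (intro member_le_sum) auto
    finally show ?thesis .
  qed
  then show thesis by (rule that)
qed

text \<open>
  The part of the geodesic at distance at most \<open>c\<close> from the edge \<open>{\<gamma> k, \<gamma> (Suc k)}\<close>, two walks
  of length at most \<open>c\<close> to the translated geodesic and a segment of the latter form a closed walk.
  The balls of radius \<open>c\<close> around the two branch points are disjoint, so a circuit through the given
  edge can pass from one to the other only along the translate.
\<close>

lemma translate_near_edge:
  assumes hyp: "four_point \<delta>" and V: "x \<in> V" "y \<in> V" and g: "g \<in> carrier G"
    and R: "d x (\<phi> g x) \<le> R" "d y (\<phi> g y) \<le> R"
    and \<gamma>: "\<gamma> 0 = x" "\<gamma> (d x y) = y" "\<And>i. i < d x y \<Longrightarrow> {\<gamma> i, \<gamma> (Suc i)} \<in> E"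
      "\<And>i. i \<le> d x y \<Longrightarrow> \<gamma> i \<in> V"
      "\<And>i j. i \<le> j \<Longrightarrow> j \<le> d x y \<Longrightarrow> d (\<gamma> i) (\<gamma> j) = j - i"
    and c: "c = 6 * \<delta>"
    and k: "R + 2 * \<delta> + c < k" "k + 1 + c + R + 2 * \<delta> < d x y"
  obtains j where "j < d x y" "k \<le> j + R + 2 * c" "j \<le> k + R + 2 * c"
    "\<phi> g ` {\<gamma> j, \<gamma> (Suc j)} \<in> near E (8 * c + 2) {\<gamma> k, \<gamma> (Suc k)}"
proof -
  define L where "L = d x y"
  note \<gamma> = \<gamma>[folded L_def] and k = k[folded L_def]
  define \<gamma>' where "\<gamma>' j = \<phi> g (\<gamma> j)" for j
  have gV: "\<phi> g x \<in> V" "\<phi> g y \<in> V" using act_closed g V by auto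
  have L': "d (\<phi> g x) (\<phi> g y) = L" unfolding L_def using d_act g V by simp
  have \<gamma>': "\<gamma>' 0 = \<phi> g x" "\<gamma>' L = \<phi> g y" "\<And>i. i \<le> L \<Longrightarrow> \<gamma>' i \<in> V"
    "\<And>i j. i \<le> j \<Longrightarrow> j \<le> L \<Longrightarrow> d (\<gamma>' i) (\<gamma>' j) = j - i"
    using \<gamma> g by (auto simp: \<gamma>'_def act_closed d_act)
  \<comment> \<open>The ends move by at most \<open>R\<close>, so a vertex farther than
    \<open>R + 2 * \<delta>\<close> from both ends stays within \<open>c\<close> of the translated
    geodesic.\<close>
  have close: "\<exists>j\<le>L. d (\<gamma> i) (\<gamma>' j) \<le> c" if i: "R + 2 * \<delta> < i" "i + R + 2 * \<delta> < L" for i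
  proof -
    have "\<gamma> i \<in> V" "d x (\<gamma> i) = i" "d (\<gamma> i) y = L - i"
      using \<gamma>(4)[of i] \<gamma>(5)[of 0 i] \<gamma>(5)[of i L] \<gamma>(1,2) i by auto
    then have mid: "d x (\<gamma> i) + d (\<gamma> i) y = L" "R + 2 * \<delta> < d x (\<gamma> i)" "R + 2 * \<delta> < d (\<gamma> i) y"
      "\<gamma> i \<in> V"
      using i by auto
    obtain j where "j \<le> L" "d (\<gamma> i) (\<gamma>' j) \<le> 6 * \<delta>"
      by (rule near_perturbed_geodesic[OF hyp V gV mid(4) _ mid(2,3) R, folded L_def, unfolded L',
            OF mid(1) \<gamma>'])
    then show ?thesis using c by auto
  qed
  \<comment> \<open>The branch points lie \<open>c\<close> before \<open>p\<close> and
    \<open>c\<close> after \<open>q\<close>. Their distance \<open>2 * c + 1\<close> makes the balls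
    of radius \<open>c\<close> about them disjoint.\<close>
  define l where "l = \<gamma> (k - c)"
  define r where "r = \<gamma> (Suc k + c)"
  define p where "p = \<gamma> k"
  define q where "q = \<gamma> (Suc k)"
  obtain \<alpha> where \<alpha>: "\<alpha> \<le> L" "d l (\<gamma>' \<alpha>) \<le> c"
  proof -
    have "R + 2 * \<delta> < k - c" "k - c + R + 2 * \<delta> < L" using k by linarith+
    then show thesis using close that unfolding l_def by blast
  qed
  obtain \<beta> where \<beta>: "\<beta> \<le> L" "d r (\<gamma>' \<beta>) \<le> c"
  proof -
    have "R + 2 * \<delta> < Suc k + c" "Suc k + c + R + 2 * \<delta> < L" using k by linarith+
    then show thesis using close that unfolding r_def by blast
  qed
  have lrV: "l \<in> V" "r \<in> V" "p \<in> V" "q \<in> V"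
    unfolding l_def r_def p_def q_def using k by (auto intro!: \<gamma>(4))
  have "d l p = c" "d r q = c" "d l q = Suc c" "d l r = 2 * c + 1"
    using \<gamma>(5)[of "k - c" k] \<gamma>(5)[of "Suc k" "Suc k + c"] \<gamma>(5)[of "k - c" "Suc k"]
      \<gamma>(5)[of "k - c" "Suc k + c"] k d_sym[of r q]
    unfolding l_def r_def p_def q_def by simp_all
  moreover have "d x l + c = k" "d x r = Suc k + c"
    using \<gamma>(5)[of 0 "k - c"] \<gamma>(5)[of 0 "Suc k + c"] k unfolding l_def r_def \<gamma>(1) by simp_all
  ultimately have dist: "d l p = c" "d r q = c" "d l q = Suc c" "d l r = 2 * c + 1"
    "d x l + c = k" "d x r = Suc k + c" .
  have \<alpha>V: "\<gamma>' \<alpha> \<in> V" "d (\<phi> g x) (\<gamma>' \<alpha>) = \<alpha>" using \<gamma>'(3)[OF \<alpha>(1)] \<gamma>'(4)[of 0 \<alpha>] \<gamma>'(1) \<alpha> by auto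
  have \<beta>V: "\<gamma>' \<beta> \<in> V" "d (\<phi> g x) (\<gamma>' \<beta>) = \<beta>" using \<gamma>'(3)[OF \<beta>(1)] \<gamma>'(4)[of 0 \<beta>] \<gamma>'(1) \<beta> by auto
  \<comment> \<open>Distances from \<open>x\<close> and from \<open>\<phi> g x\<close> differ by at
    most \<open>R\<close>; this confines \<open>\<alpha>\<close> and \<open>\<beta>\<close> to a
    window around \<open>k\<close>.\<close>
  have gap: "d (\<phi> g x) v \<le> R + d x u + d u v" "d x u \<le> R + d (\<phi> g x) v + d u v"
    if "u \<in> V" "v \<in> V" for u v
    using d_triangle[OF gV(1) V(1) that(2)] d_triangle[OF V(1) that(1) that(2)]
      d_triangle[OF V(1) gV(1) that(1)] d_triangle[OF gV(1) that(2) that(1)] R(1)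
      d_sym[of x "\<phi> g x"] d_sym[of u v] by linarith+
  have "\<alpha> \<le> R + k" "k \<le> \<alpha> + R + 2 * c"
    using gap[OF lrV(1) \<alpha>V(1)] dist(5) \<alpha>V(2) \<alpha>(2) by linarith+
  moreover have "\<beta> \<le> Suc k + R + 2 * c" "k \<le> \<beta> + R + 2 * c"
    using gap[OF lrV(2) \<beta>V(1)] dist(6) \<beta>V(2) \<beta>(2) by linarith+
  ultimately have pos: "\<alpha> \<le> R + k" "k \<le> \<alpha> + R + 2 * c" "\<beta> \<le> Suc k + R + 2 * c"
    "k \<le> \<beta> + R + 2 * c" .
  have ab: "d (\<gamma>' \<alpha>) (\<gamma>' \<beta>) \<le> 4 * c + 1"
    using d_triangle[OF \<alpha>V(1) lrV(1) \<beta>V(1)] d_triangle[OF lrV(1,2) \<beta>V(1)] d_sym[of l "\<gamma>' \<alpha>"]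
      dist \<alpha> \<beta> by linarith
  \<comment> \<open>Since \<open>p\<close> is at distance \<open>c\<close> from \<open>l\<close> and
    \<open>q\<close> at distance \<open>c + 1\<close>, the edge \<open>{p, q}\<close> leaves the
    ball \<open>A\<close>.\<close>
  define A where "A = {z. d l z \<le> c}"
  define B where "B = {z. d r z \<le> c}"
  define m where "m = min \<alpha> \<beta>"
  define n where "n = max \<alpha> \<beta>"
  define H1 where "H1 = {e \<in> E. e \<subseteq> A}"
  define H2 where "H2 = {\<phi> g ` {\<gamma> j, \<gamma> (Suc j)} | j. m \<le> j \<and> j < n}"
  define H3 where "H3 = {e \<in> E. e \<subseteq> B}"
  define H where "H = H1 \<union> H2 \<union> H3"
  have nL: "n \<le> L" unfolding n_def using \<alpha> \<beta> by simp
  have HE: "H \<subseteq> E"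
    unfolding H_def H1_def H2_def H3_def using edge_closed[OF g \<gamma>(3)] nL by fastforce
  have ballA: "(l, v) \<in> adj H ^^ d l v" if "v \<in> V" "d l v \<le> c" for v
    using walk_in_ball[OF walk_dist[OF lrV(1) that(1)] that(2)]
    by (rule adj_relpow_mono) (auto simp: H_def H1_def A_def)
  have ballB: "(r, v) \<in> adj H ^^ d r v" if "v \<in> V" "d r v \<le> c" for v
    using walk_in_ball[OF walk_dist[OF lrV(2) that(1)] that(2)]
    by (rule adj_relpow_mono) (auto simp: H_def H3_def B_def)
  have w1: "(p, l) \<in> adj H ^^ c"
    using adj_relpow_sym[OF ballA[OF lrV(3)]] dist by simp
  have w2: "(l, \<gamma>' \<alpha>) \<in> adj H ^^ d l (\<gamma>' \<alpha>)"
    by (rule ballA[OF \<alpha>V(1) \<alpha>(2)])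
  have w3: "(\<gamma>' \<alpha>, \<gamma>' \<beta>) \<in> adj H ^^ (n - m)"
  proof -
    have "(\<gamma>' m, \<gamma>' n) \<in> adj H ^^ (n - m)"
      unfolding relpow_fun_conv
    proof (intro exI[of _ "\<lambda>i. \<gamma>' (m + i)"] conjI allI impI)
      show "\<gamma>' (m + (n - m)) = \<gamma>' n" by (simp add: m_def n_def)
      fix i assume "i < n - m"
      then have "\<phi> g ` {\<gamma> (m + i), \<gamma> (Suc (m + i))} \<in> H2"
        unfolding H2_def by (intro CollectI exI[of _ "m + i"]) auto
      then show "(\<gamma>' (m + i), \<gamma>' (m + Suc i)) \<in> adj H"
        by (simp add: adj_iff H_def \<gamma>'_def)
    qed simp
    \<comment> \<open>The order of \<open>\<alpha>\<close> and \<open>\<beta>\<close> is unknown, so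
      the segment may be traversed backwards.\<close>
    from this adj_relpow_sym[OF this] show ?thesis
      by (cases "\<alpha> \<le> \<beta>") (simp_all add: m_def n_def)
  qed
  have w4: "(\<gamma>' \<beta>, r) \<in> adj H ^^ d r (\<gamma>' \<beta>)"
    by (rule adj_relpow_sym[OF ballB[OF \<beta>V(1) \<beta>(2)]])
  have w5: "(r, q) \<in> adj H ^^ c"
    using ballB[OF lrV(4)] dist by simp
  have walk: "(p, q) \<in> adj H ^^ (c + d l (\<gamma>' \<alpha>) + (n - m) + d r (\<gamma>' \<beta>) + c)"
    by (rule relpow_trans[OF relpow_trans[OF relpow_trans[OF relpow_trans[OF w1 w2] w3] w4] w5])
  have nm: "n - m = d (\<gamma>' \<alpha>) (\<gamma>' \<beta>)"
    using \<gamma>'(4)[of \<alpha> \<beta>] \<gamma>'(4)[of \<beta> \<alpha>] d_sym[of "\<gamma>' \<alpha>" "\<gamma>' \<beta>"] \<alpha> \<beta>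
    by (cases "\<alpha> \<le> \<beta>") (auto simp: m_def n_def)
  have pq: "p \<in> A" "q \<notin> A" "{p, q} \<in> E"
    using dist \<gamma>(3)[of k] k by (auto simp: A_def p_def q_def)
  obtain f where f: "f \<in> H" "f \<in> near E (Suc (c + d l (\<gamma>' \<alpha>) + (n - m) + d r (\<gamma>' \<beta>) + c)) {p, q}"
      "f \<inter> A \<noteq> {}" "\<not> f \<subseteq> A"
    by (rule crossing_edge[OF HE walk pq])
  \<comment> \<open>Edges of \<open>H1\<close> stay inside \<open>A\<close> and those of
    \<open>H3\<close> do not meet it, so the crossing edge belongs to the translate.\<close>
  have "f \<notin> H3"
  proof
    assume "f \<in> H3"
    then obtain z where "z \<in> A" "z \<in> B" "z \<in> V" using f(3) edge_obtain unfolding H3_def by blast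
    then show False
      using d_triangle[OF lrV(1) _ lrV(2), of z] dist d_sym[of r z] by (simp add: A_def B_def)
  qed
  then obtain j where j: "f = \<phi> g ` {\<gamma> j, \<gamma> (Suc j)}" "m \<le> j" "j < n"
    using f unfolding H_def H1_def H2_def by blast
  \<comment> \<open>At most \<open>4 * c\<close> for the four short walks, \<open>4 * c + 1\<close>
    for the segment of the translate, and 1 for the closing edge.\<close>
  have "f \<in> near E (8 * c + 2) {p, q}"
    by (rule subsetD[OF near_mono f(2)]) (use nm ab \<alpha>(2) \<beta>(2) in linarith)
  then show thesis
    using that[of j] j nL pos unfolding L_def[symmetric] p_def q_def m_def n_def by auto
qed

end

section \<open>Commuting elements and the global fixed vertex\<close>

context torsion_free_action
begin

lemma displacement_mult:
  assumes "g \<in> carrier G" "h \<in> carrier G" "x \<in> V"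
  shows "d x (\<phi> (g \<otimes> h) x) \<le> d x (\<phi> g x) + d x (\<phi> h x)"
  using d_triangle[of x "\<phi> g x" "\<phi> g (\<phi> h x)"] d_act[of g x "\<phi> h x"] assms
  by (simp add: act_closed composition_rule)

lemma displacement_pow:
  assumes g: "g \<in> carrier G" and x: "x \<in> V"
  shows "d x (\<phi> (g [^] (n::nat)) x) \<le> n * d x (\<phi> g x)"
proof (induction n)
  case 0
  then show ?case using act_one[OF x] by (simp add: d_refl)
next
  case (Suc n)
  then show ?case using displacement_mult[of "g [^] n" g x] g x by simp
qed

lemma commuting_pair_bounded_orbit:
  assumes hyp: "four_point \<delta>" and fin: "finite (orbits G E (edge_action \<phi>))"
    and ab: "a \<in> carrier G" "b \<in> carrier G" "a \<otimes> b = b \<otimes> a"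
    and indep: "\<And>(i::nat) (j::nat) (k::nat) (l::nat). a [^] i \<otimes> b [^] j = a [^] k \<otimes> b [^] l \<Longrightarrow> i = k \<and> j = l"
    and x: "x \<in> V"
  shows "\<exists>R. \<forall>n::nat. d x (\<phi> (a [^] n) x) \<le> R"
proof (rule ccontr)
  assume unbounded: "\<not> ?thesis"
  define c where "c = 6 * \<delta>"
  obtain M where M: "\<And>e. e \<in> E \<Longrightarrow> card (near E (8 * c + 2) e) \<le> M"
    using card_near_bounded[OF fin] by blast
  define D where "D = d x (\<phi> a x) + d x (\<phi> b x)"
  \<comment> \<open>\<open>K\<close> is tuned to the final count; \<open>R\<close> then bounds the
    displacement of \<open>x\<close> by every \<open>g i j\<close> with \<open>i\<close> and
    \<open>j\<close> at most \<open>K\<close>.\<close>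
  define K where "K = M * (2 * D + 4 * c + 1)"
  define R where "R = K * D"
  \<comment> \<open>The least position allowed by \<open>translate_near_edge\<close>; unboundedness
    supplies a geodesic continuing far enough beyond it.\<close>
  define k where "k = R + 2 * \<delta> + c + 1"
  obtain n :: nat where n: "k + 1 + c + R + 2 * \<delta> < d x (\<phi> (a [^] n) x)"
    using unbounded by (meson not_le)
  define y where "y = \<phi> (a [^] n) x"
  define L where "L = d x y"
  have an: "a [^] n \<in> carrier G" using ab by simp
  have y: "y \<in> V" unfolding y_def using act_closed[OF an x] .
  have kL: "k + 1 + c + R + 2 * \<delta> < L" using n by (simp add: L_def y_def)
  define g where "g i j = a [^] i \<otimes> b [^] j" for i j :: nat
  have gG: "g i j \<in> carrier G" for i j unfolding g_def using ab by simp
  have disp: "d x (\<phi> (g i j) x) \<le> R" if "i \<le> K" "j \<le> K" for i j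
  proof -
    have "d x (\<phi> (g i j) x) \<le> i * d x (\<phi> a x) + j * d x (\<phi> b x)"
      using displacement_mult[of "a [^] i" "b [^] j" x] displacement_pow[OF ab(1) x, of i]
        displacement_pow[OF ab(2) x, of j] ab x by (simp add: g_def)
    also have "\<dots> \<le> K * d x (\<phi> a x) + K * d x (\<phi> b x)"
      using that by (intro add_mono mult_right_mono) auto
    finally show ?thesis by (simp add: R_def D_def algebra_simps)
  qed
  \<comment> \<open>The isometry \<open>a [^] n\<close> takes \<open>x\<close> to \<open>y\<close>
    and commutes with \<open>g i j\<close>, so \<open>y\<close> is displaced as far as
    \<open>x\<close>.\<close>
  have disp': "d y (\<phi> (g i j) y) \<le> R" if "i \<le> K" "j \<le> K" for i j
  proof -
    have "b [^] j \<otimes> a = a \<otimes> b [^] j" using ab by (intro group_commutes_pow) auto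
    then have "a [^] n \<otimes> b [^] j = b [^] j \<otimes> a [^] n"
      using ab by (intro group_commutes_pow) auto
    then have "a [^] n \<otimes> g i j = g i j \<otimes> a [^] n"
      using ab nat_pow_comm[of a n i] by (simp add: g_def flip: m_assoc) (simp add: m_assoc)
    then have "\<phi> (g i j) y = \<phi> (a [^] n) (\<phi> (g i j) x)"
      unfolding y_def using composition_rule[OF x gG an, of i j] composition_rule[OF x an gG, of i j]
      by metis
    then show ?thesis
      unfolding y_def using disp[OF that] d_act[OF an x act_closed[OF gG x]] y_def by simp
  qed
  obtain \<gamma> where \<gamma>: "\<gamma> 0 = x" "\<gamma> (d x y) = y" "\<And>i. i < d x y \<Longrightarrow> {\<gamma> i, \<gamma> (Suc i)} \<in> E"
    "\<And>i. i \<le> d x y \<Longrightarrow> \<gamma> i \<in> V"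
    "\<And>i j. i \<le> j \<Longrightarrow> j \<le> d x y \<Longrightarrow> d (\<gamma> i) (\<gamma> j) = j - i"
    using geodesic[OF x y] by metis
  define N where "N = near E (8 * c + 2) {\<gamma> k, \<gamma> (Suc k)}"
  have eE: "{\<gamma> k, \<gamma> (Suc k)} \<in> E" using \<gamma>(3)[of k] kL by (simp add: L_def)
  have ex: "\<exists>t. t < L \<and> k \<le> t + R + 2 * c \<and> t \<le> k + R + 2 * c \<and>
      \<phi> (g i j) ` {\<gamma> t, \<gamma> (Suc t)} \<in> N" if "i \<le> K" "j \<le> K" for i j
  proof -
    have "R + 2 * \<delta> + c < k" by (simp add: k_def)
    then show ?thesis
      using translate_near_edge[OF hyp x y gG disp[OF that] disp'[OF that] \<gamma> c_def _ kL[unfolded L_def]]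
      unfolding N_def L_def by blast
  qed
  define t where "t i j = (SOME t. t < L \<and> k \<le> t + R + 2 * c \<and> t \<le> k + R + 2 * c \<and>
      \<phi> (g i j) ` {\<gamma> t, \<gamma> (Suc t)} \<in> N)" for i j
  have t: "t i j < L" "k \<le> t i j + R + 2 * c" "t i j \<le> k + R + 2 * c"
      "\<phi> (g i j) ` {\<gamma> (t i j), \<gamma> (Suc (t i j))} \<in> N" if "i \<le> K" "j \<le> K" for i j
    using someI_ex[OF ex[OF that]] unfolding t_def[symmetric] by auto
  \<comment> \<open>A position on the geodesic and the image of the edge there determine
    \<open>g i j\<close>, hence \<open>i\<close> and \<open>j\<close> by independence.\<close>
  define F where "F = (\<lambda>(i, j). (t i j, \<phi> (g i j) ` {\<gamma> (t i j), \<gamma> (Suc (t i j))}))"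
  have "i = i' \<and> j = j'" if ij: "i \<le> K" "j \<le> K" and eq: "F (i, j) = F (i', j')" for i j i' j'
  proof -
    have tt: "t i' j' = t i j" using eq by (simp add: F_def)
    have "\<phi> (g i j) ` {\<gamma> (t i j), \<gamma> (Suc (t i j))} = \<phi> (g i' j') ` {\<gamma> (t i j), \<gamma> (Suc (t i j))}"
      using eq unfolding F_def prod.case tt by (rule Pair_inject)
    then have "g i j = g i' j'"
      by (rule act_edge_cancel[OF gG gG \<gamma>(3)[OF t(1)[OF ij, unfolded L_def]]])
    then show ?thesis unfolding g_def by (rule indep)
  qed
  then have inj: "inj_on F ({..K} \<times> {..K})" unfolding inj_on_def by force
  have "F ` ({..K} \<times> {..K}) \<subseteq> {k - (R + 2 * c)..k + (R + 2 * c)} \<times> N"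
    using t by (fastforce simp: F_def)
  moreover have "finite N" unfolding N_def by (rule finite_near[OF fine eE])
  ultimately have "card ({..K} \<times> {..K}) \<le> card ({k - (R + 2 * c)..k + (R + 2 * c)} \<times> N)"
    using card_image[OF inj] by (metis card_mono finite_SigmaI finite_atLeastAtMost)
  then have "(K + 1) * (K + 1) \<le> card {k - (R + 2 * c)..k + (R + 2 * c)} * card N"
    by (simp add: card_cartesian_product)
  \<comment> \<open>As \<open>R = K * D\<close>, the window of positions grows linearly in
    \<open>K\<close>. The choice of \<open>K\<close> turns the bound into
    \<open>(K + 1) * K\<close>, which is too small.\<close>
  also have "\<dots> \<le> (2 * (R + 2 * c) + 1) * M"
    using M[OF eE] unfolding N_def by (intro mult_mono) auto
  also have "2 * (R + 2 * c) + 1 \<le> (K + 1) * (2 * D + 4 * c + 1)"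
    unfolding R_def by (simp add: algebra_simps)
  then have "(2 * (R + 2 * c) + 1) * M \<le> (K + 1) * (2 * D + 4 * c + 1) * M"
    by (rule mult_right_mono) simp
  also have "\<dots> = (K + 1) * K" unfolding K_def by (simp only: mult_ac)
  finally show False by simp
qed

text \<open>The vertex \<open>\<phi> h v\<close> is again fixed by \<open>g\<close>, hence equals
  \<open>v\<close> by uniqueness.\<close>

lemma commuting_fixes:
  assumes "g \<in> carrier G" "g \<noteq> \<one>" "h \<in> carrier G" "h \<otimes> g = g \<otimes> h" "v \<in> V" "\<phi> g v = v"
  shows "\<phi> h v = v"
proof -
  have "\<phi> g (\<phi> h v) = \<phi> h v"
    using assms composition_rule[OF assms(5,1,3)] composition_rule[OF assms(5,3,1)] by simp
  then show ?thesis
    using fixed_vertex_unique[OF assms(1,2) act_closed[OF assms(3,5)] assms(5)] assms(6) by blast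
qed

text \<open>The fixed vertex of \<open>a\<close> is handed on to \<open>z\<close> and then to
  \<open>h \<otimes> a \<otimes> inv h\<close>. So \<open>a\<close> also fixes the image of
  \<open>v\<close> under \<open>inv h\<close>, which by uniqueness is \<open>v\<close>
  again.\<close>

lemma global_fixed_vertex:
  assumes hyp: "four_point \<delta>" and fin: "finite (orbits G E (edge_action \<phi>))" and V: "V \<noteq> {}"
    and ab: "a \<in> carrier G" "a \<noteq> \<one>" "b \<in> carrier G" "a \<otimes> b = b \<otimes> a"
    and indep: "\<And>(i::nat) (j::nat) (k::nat) (l::nat). a [^] i \<otimes> b [^] j = a [^] k \<otimes> b [^] l \<Longrightarrow> i = k \<and> j = l"
    and link: "\<And>h. h \<in> carrier G \<Longrightarrow> \<exists>z\<in>carrier G. z \<noteq> \<one> \<and> z \<otimes> a = a \<otimes> z \<and>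
        z \<otimes> (h \<otimes> a \<otimes> inv h) = (h \<otimes> a \<otimes> inv h) \<otimes> z"
  shows "\<exists>v\<in>V. \<forall>h\<in>carrier G. \<phi> h v = v"
proof -
  obtain x where x: "x \<in> V" using V by blast
  obtain R where "\<And>n::nat. d x (\<phi> (a [^] n) x) \<le> R"
    using commuting_pair_bounded_orbit[OF hyp fin ab(1,3,4) indep x] by blast
  then obtain v where v: "v \<in> V" "\<phi> a v = v"
    using bounded_orbit_imp_fixed[OF ab(1,2) x] by blast
  have "\<phi> h v = v" if h: "h \<in> carrier G" for h
  proof -
    define a' where "a' = h \<otimes> a \<otimes> inv h"
    have a': "a' \<in> carrier G" unfolding a'_def using h ab by simp
    obtain z where z: "z \<in> carrier G" "z \<noteq> \<one>" "z \<otimes> a = a \<otimes> z" "z \<otimes> a' = a' \<otimes> z"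
      using link[OF h] unfolding a'_def by blast
    have "\<phi> z v = v" by (rule commuting_fixes[OF ab(1,2) z(1,3) v])
    then have "\<phi> a' v = v" by (rule commuting_fixes[OF z(1,2) a' z(4)[symmetric] v(1)])
    moreover have "inv h \<otimes> a' = a \<otimes> inv h"
      unfolding a'_def using h ab by (simp add: m_assoc[symmetric])
    ultimately have "\<phi> a (\<phi> (inv h) v) = \<phi> (inv h) v"
      using composition_rule[OF v(1) inv_closed[OF h] a'] composition_rule[OF v(1) ab(1) inv_closed[OF h]]
      by simp
    then have "\<phi> (inv h) v = v"
      using fixed_vertex_unique[OF ab(1,2) act_closed[OF inv_closed[OF h] v(1)] v(1)] v(2) by blast
    then show ?thesis using act_inv'[OF h v(1)] by simp
  qed
  with v(1) show ?thesis by blast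
qed

text \<open>If only the identity fixed \<open>w\<close>, then for each representative edge and each
  of its ends at most one element would carry that end to \<open>w\<close>, leaving finitely many
  edges at \<open>w\<close>.\<close>

lemma infinite_valence_stabilizer:
  assumes fin: "finite (orbits G E (edge_action \<phi>))" and w: "infinite_valence E w"
  shows "\<exists>g\<in>carrier G. g \<noteq> \<one> \<and> \<phi> g w = w"
proof (rule ccontr)
  assume free: "\<not> ?thesis"
  obtain C where C: "finite C" "C \<subseteq> E" "\<forall>e\<in>E. \<exists>h\<in>carrier G. \<exists>e0\<in>C. e = \<phi> h ` e0"
    by (rule edge_representatives[OF fin])
  define S where "S e0 u = {\<phi> h ` e0 | h. h \<in> carrier G \<and> w = \<phi> h u}" for e0 u
  have "finite (S e0 u)" if e0: "e0 \<in> C" "u \<in> e0" for e0 u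
  proof -
    have uV: "u \<in> V" using e0 C(2) edge_obtain by blast
    have same: "h = k" if h: "h \<in> carrier G" "w = \<phi> h u" and k: "k \<in> carrier G" "w = \<phi> k u" for h k
    proof -
      have kh: "k \<otimes> inv h \<in> carrier G" using h k by simp
      have "\<phi> (k \<otimes> inv h) w = \<phi> (k \<otimes> inv h \<otimes> h) u"
        unfolding composition_rule[OF uV kh h(1)] h(2) ..
      also have "\<dots> = w" unfolding k(2) using h k by (simp add: m_assoc)
      finally have "k \<otimes> inv h = \<one>" using free kh by metis
      then show "h = k" using h(1) k(1) inv_solve_right'[of \<one> k h] by simp
    qed
    show ?thesis
    proof (cases "\<exists>h. h \<in> carrier G \<and> w = \<phi> h u")
      case True
      then obtain h where h: "h \<in> carrier G" "w = \<phi> h u" by blast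
      have "S e0 u \<subseteq> {\<phi> h ` e0}"
      proof
        fix e assume "e \<in> S e0 u"
        then obtain k where k: "e = \<phi> k ` e0" "k \<in> carrier G" "w = \<phi> k u"
          unfolding S_def by (elim CollectE exE conjE)
        have "h = k" by (rule same[OF h k(2,3)])
        then show "e \<in> {\<phi> h ` e0}" unfolding k(1) by (simp only: singleton_iff)
      qed
      then show ?thesis by (rule finite_subset) simp
    next
      case False
      then have "S e0 u = {}" by (simp add: S_def)
      then show ?thesis by simp
    qed
  qed
  moreover have "finite e0" if "e0 \<in> C" for e0
    using that C(2) by (auto elim: edge_obtain)
  ultimately have "finite (\<Union>e0\<in>C. \<Union>u\<in>e0. S e0 u)" using C(1) by auto
  moreover have "{e \<in> E. w \<in> e} \<subseteq> (\<Union>e0\<in>C. \<Union>u\<in>e0. S e0 u)"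
  proof
    fix e assume "e \<in> {e \<in> E. w \<in> e}"
    then have e: "e \<in> E" "w \<in> e" by auto
    obtain h e0 where h: "h \<in> carrier G" "e0 \<in> C" "e = \<phi> h ` e0"
      using bspec[OF C(3) e(1)] by (elim bexE) (rule that)
    then obtain u where u: "u \<in> e0" "w = \<phi> h u" using e(2) by auto
    have "e \<in> S e0 u" unfolding S_def h(3) using h(1) u(2) by (intro CollectI exI[of _ h] conjI refl)
    then show "e \<in> (\<Union>e0\<in>C. \<Union>u\<in>e0. S e0 u)" using h(2) u(1) by (intro UN_I)
  qed
  ultimately show False using w finite_subset unfolding infinite_valence_def by blast
qed

end

section \<open>A criterion for arbitrary groups\<close>

context group
begin

lemma conjugate_proper:
  assumes "L \<subseteq> carrier G" "g \<in> carrier G" "g <# L #> inv g = carrier G"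
  shows "L = carrier G"
proof
  show "carrier G \<subseteq> L"
  proof
    fix x assume x: "x \<in> carrier G"
    then have "g \<otimes> x \<otimes> inv g \<in> g <# L #> inv g" using assms by simp
    then obtain l where l: "l \<in> L" "g \<otimes> x \<otimes> inv g = g \<otimes> l \<otimes> inv g"
      by (auto simp: l_coset_def r_coset_def)
    then have "l \<in> carrier G" using assms by blast
    then have "x = l" using l x assms(2) by simp
    then show "x \<in> L" using l by simp
  qed
qed fact

text \<open>Separates the geometry from the computations in \<open>thompson_F\<close>. The
  contradiction is a vertex \<open>w\<close> whose stabiliser is conjugate to a proper subgroup
  although \<open>w\<close> is the global fixed vertex.\<close>

lemma not_strongly_relatively_hyperbolicI:
  assumes torsion_free: "\<And>g n. g \<in> carrier G \<Longrightarrow> g [^] (n::nat) = \<one> \<Longrightarrow> 0 < n \<Longrightarrow> g = \<one>"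
    and ab: "a \<in> carrier G" "a \<noteq> \<one>" "b \<in> carrier G" "a \<otimes> b = b \<otimes> a"
    and indep: "\<And>(i::nat) (j::nat) (k::nat) (l::nat). a [^] i \<otimes> b [^] j = a [^] k \<otimes> b [^] l \<Longrightarrow> i = k \<and> j = l"
    and link: "\<And>h. h \<in> carrier G \<Longrightarrow> \<exists>z\<in>carrier G. z \<noteq> \<one> \<and> z \<otimes> a = a \<otimes> z \<and>
        z \<otimes> (h \<otimes> a \<otimes> inv h) = (h \<otimes> a \<otimes> inv h) \<otimes> z"
  shows "not_strongly_relatively_hyperbolic TYPE('v) G"
  unfolding not_strongly_relatively_hyperbolic_def
proof
  assume "\<exists>\<L>. finite \<L> \<and> \<L> \<noteq> {} \<and> (\<forall>L\<in>\<L>. proper_fg_subgroup L G) \<and>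
    strongly_hyperbolic_relative TYPE('v) G \<L>"
  then obtain \<L> where \<L>: "\<L> \<noteq> {}" "\<forall>L\<in>\<L>. proper_fg_subgroup L G"
    and rel: "strongly_hyperbolic_relative TYPE('v) G \<L>"
    by (elim exE conjE)
  obtain V :: "'v set" and E \<phi> where VE: "simple_graph V E" "connected_graph V E"
    and act: "graph_action G V E \<phi>"
    and hyp: "gromov_hyperbolic (edge_points E) (realization_dist E)" and fine: "fine_graph E"
    and fin: "finite (orbits G E (edge_action \<phi>))"
    and stab: "\<forall>e\<in>E. finite (stabilizer G (edge_action \<phi>) e)"
    and per: "{stabilizer G \<phi> v | v. v \<in> V \<and> infinite_valence E v} = conjugates G \<L>"
    using rel unfolding strongly_hyperbolic_relative_def by (elim exE conjE)
  interpret group_action G V \<phi> using act by (simp add: graph_action_def)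
  interpret torsion_free_action V E G \<phi>
    using VE act fine stab torsion_free by unfold_locales (auto simp: graph_action_def)
  obtain L where L: "L \<in> \<L>" using \<L> by blast
  \<comment> \<open>Conjugating \<open>L\<close> by the identity shows that some vertex has infinite
    valence.\<close>
  then have "\<one> <# L #> inv \<one> \<in> conjugates G \<L>" unfolding conjugates_def by blast
  then obtain w where w: "w \<in> V" "infinite_valence E w" "stabilizer G \<phi> w \<in> conjugates G \<L>"
    unfolding per[symmetric] by blast
  obtain g K where g: "g \<in> carrier G" "K \<in> \<L>" "stabilizer G \<phi> w = g <# K #> inv g"
    using w(3) unfolding conjugates_def by blast
  then have K: "K \<subseteq> carrier G" "K \<noteq> carrier G"
    using \<L>(2) by (auto simp: proper_fg_subgroup_def subgroup_def)
  have "E \<noteq> {}" using w(2) by (auto simp: infinite_valence_def)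
  then obtain \<delta> where \<delta>: "four_point \<delta>" by (rule gromov_hyperbolic_imp_four_point[OF hyp])
  have "V \<noteq> {}" using w by blast
  then obtain v where v: "v \<in> V" "\<And>h. h \<in> carrier G \<Longrightarrow> \<phi> h v = v"
    using global_fixed_vertex[OF \<delta> fin _ ab indep link] by blast
  obtain h where h: "h \<in> carrier G" "h \<noteq> \<one>" "\<phi> h w = w"
    using infinite_valence_stabilizer[OF fin w(2)] by blast
  have "w = v" by (rule fixed_vertex_unique[OF h(1,2) w(1) v(1) h(3) v(2)[OF h(1)]])
  then have "stabilizer G \<phi> w = carrier G" using v(2) by (auto simp: stabilizer_def)
  then show False using conjugate_proper[OF K(1) g(1)] g(3) K(2) by simp
qed

end

section \<open>Thompson's group\<close>

lemma thompson_mult: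
  assumes "f \<in> thompson_carrier" "g \<in> thompson_carrier"
  shows "f \<otimes>\<^bsub>thompson_F\<^esub> g = compose {0..1} f g"
  using assms thompson_carrier_Bij by (auto simp: thompson_F_def BijGroup_def)

lemma thompson_one: "\<one>\<^bsub>thompson_F\<^esub> = (\<lambda>x\<in>{0..1}. x)"
  by (simp add: thompson_F_def BijGroup_def)

lemma carrier_thompson: "carrier thompson_F = thompson_carrier"
  by (simp add: thompson_F_def)

lemma thompson_range: "f \<in> thompson_carrier \<Longrightarrow> x \<in> {0..1} \<Longrightarrow> f x \<in> {0..1}"
  using thompson_homeomorphism[of f] by (auto simp: homeomorphism_def)

lemma thompson_mult_apply:
  assumes "f \<in> carrier thompson_F" "g \<in> carrier thompson_F" "x \<in> {0..1}"
  shows "(f \<otimes>\<^bsub>thompson_F\<^esub> g) x = f (g x)"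
  using assms by (simp add: carrier_thompson thompson_mult compose_def)

lemma thompson_eqI:
  assumes "f \<in> carrier thompson_F" "g \<in> carrier thompson_F" "\<And>x. x \<in> {0..1} \<Longrightarrow> f x = g x"
  shows "f = g"
  using assms by (intro extensionalityI[of f "{0..1}"]) (auto simp: carrier_thompson thompson_carrier_def)

interpretation thompson: group thompson_F
  by (rule group_thompson_F)

section \<open>Torsion-freeness\<close>

lemma thompson_pow_less:
  assumes f: "f \<in> carrier thompson_F" and x: "x \<in> {0..1}" "x < f x" and n: "0 < n"
  shows "x < (f [^]\<^bsub>thompson_F\<^esub> (n::nat)) x"
  using n
proof (induction n rule: nat_induct_non_zero)
  case 1
  then show ?case using f x by simp
next
  case (Suc n)
  have fx: "f x \<in> {0..1}" using thompson_range f x(1) by (simp add: carrier_thompson)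
  have "(f [^]\<^bsub>thompson_F\<^esub> n) x < (f [^]\<^bsub>thompson_F\<^esub> n) (f x)"
    using thompson_less_iff[of "f [^]\<^bsub>thompson_F\<^esub> n", OF _ x(1) fx] x(2) f
      thompson.nat_pow_closed[of f n] by (simp add: carrier_thompson)
  then show ?case using Suc f x(1) by (simp add: thompson_mult_apply)
qed

lemma thompson_pow_greater:
  assumes f: "f \<in> carrier thompson_F" and x: "x \<in> {0..1}" "f x < x" and n: "0 < n"
  shows "(f [^]\<^bsub>thompson_F\<^esub> (n::nat)) x < x"
  using n
proof (induction n rule: nat_induct_non_zero)
  case 1
  then show ?case using f x by simp
next
  case (Suc n)
  have fx: "f x \<in> {0..1}" using thompson_range f x(1) by (simp add: carrier_thompson)
  have "(f [^]\<^bsub>thompson_F\<^esub> n) (f x) < (f [^]\<^bsub>thompson_F\<^esub> n) x"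
    using thompson_less_iff[of "f [^]\<^bsub>thompson_F\<^esub> n", OF _ fx x(1)] x(2) f
      thompson.nat_pow_closed[of f n] by (simp add: carrier_thompson)
  then show ?case using Suc f x(1) by (simp add: thompson_mult_apply)
qed

text \<open>The maps preserve the order, so every positive power displaces a moved point in the same
  direction as \<open>f\<close> does.\<close>

lemma thompson_torsion_free:
  assumes f: "f \<in> carrier thompson_F" and n: "0 < (n::nat)" "f [^]\<^bsub>thompson_F\<^esub> n = \<one>\<^bsub>thompson_F\<^esub>"
  shows "f = \<one>\<^bsub>thompson_F\<^esub>"
proof (rule thompson_eqI[OF f thompson.one_closed])
  fix x :: real assume x: "x \<in> {0..1}"
  then have "(f [^]\<^bsub>thompson_F\<^esub> n) x = x" by (simp add: n(2) thompson_one)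
  then have "f x = x"
    using thompson_pow_less[OF f x _ n(1)] thompson_pow_greater[OF f x _ n(1)]
    by (cases x "f x" rule: linorder_cases) auto
  then show "f x = \<one>\<^bsub>thompson_F\<^esub> x" using x by (simp add: thompson_one)
qed

section \<open>Elements supported in an interval\<close>

definition fixator :: "real set \<Rightarrow> (real \<Rightarrow> real) set" where
  "fixator S = {f \<in> carrier thompson_F. \<forall>x\<in>S. f x = x}"

lemma subgroup_fixator:
  assumes S: "S \<subseteq> {0..1}"
  shows "subgroup (fixator S) thompson_F"
proof (rule thompson.subgroupI)
  show "fixator S \<subseteq> carrier thompson_F" by (auto simp: fixator_def)
  show "fixator S \<noteq> {}"
    using thompson.one_closed S by (auto simp: fixator_def thompson_one intro!: exI[of _ "\<one>\<^bsub>thompson_F\<^esub>"])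
  fix f assume f: "f \<in> fixator S"
  then have fG: "f \<in> carrier thompson_F" by (simp add: fixator_def)
  show "f \<otimes>\<^bsub>thompson_F\<^esub> g \<in> fixator S" if "g \<in> fixator S" for g
    using f that S by (auto simp: fixator_def thompson_mult_apply subset_iff)
  show "inv\<^bsub>thompson_F\<^esub> f \<in> fixator S"
  proof -
    have "(inv\<^bsub>thompson_F\<^esub> f) x = x" if x: "x \<in> S" for x
    proof -
      have x01: "x \<in> {0..1}" using x S by blast
      have "(inv\<^bsub>thompson_F\<^esub> f) (f x) = x"
        using thompson_mult_apply[OF thompson.inv_closed[OF fG] fG x01] thompson.l_inv[OF fG] x01
        by (simp add: thompson_one)
      then show ?thesis using f x by (simp add: fixator_def)
    qed
    then show ?thesis using fG by (simp add: fixator_def)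
  qed
qed

lemma fixator_disjoint:
  assumes "f \<in> fixator {0..t}" "f \<in> fixator {t..1}"
  shows "f = \<one>\<^bsub>thompson_F\<^esub>"
proof (rule thompson_eqI[OF _ thompson.one_closed])
  show "f \<in> carrier thompson_F" using assms by (simp add: fixator_def)
  fix x :: real assume "x \<in> {0..1}"
  then show "f x = \<one>\<^bsub>thompson_F\<^esub> x"
    using assms by (cases "x \<le> t") (auto simp: fixator_def thompson_one)
qed

text \<open>Both maps preserve \<open>[0, t]\<close> and \<open>[t, 1]\<close>, and on each of these
  intervals one of them is the identity.\<close>

lemma fixator_commute:
  assumes f: "f \<in> fixator {t..1}" and g: "g \<in> fixator {0..t}" and t: "t \<in> {0..1}"
  shows "f \<otimes>\<^bsub>thompson_F\<^esub> g = g \<otimes>\<^bsub>thompson_F\<^esub> f"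
proof (rule thompson_eqI)
  have G: "f \<in> carrier thompson_F" "g \<in> carrier thompson_F" using f g by (auto simp: fixator_def)
  then have C: "f \<in> thompson_carrier" "g \<in> thompson_carrier" by (simp_all add: carrier_thompson)
  show "f \<otimes>\<^bsub>thompson_F\<^esub> g \<in> carrier thompson_F" "g \<otimes>\<^bsub>thompson_F\<^esub> f \<in> carrier thompson_F"
    using G by auto
  fix x :: real assume x: "x \<in> {0..1}"
  have "f t = t" "g t = t" using f g t by (auto simp: fixator_def)
  then have cmp: "f x \<le> t \<longleftrightarrow> x \<le> t" "g x \<ge> t \<longleftrightarrow> x \<ge> t"
    using thompson_less_iff[OF C(1) t x] thompson_less_iff[OF C(2) x t] by auto
  have "f x \<in> {0..1}" "g x \<in> {0..1}" using thompson_range C x by auto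
  then have "f (g x) = g (f x)"
    using f g x cmp by (cases "x \<le> t") (auto simp: fixator_def)
  then show "(f \<otimes>\<^bsub>thompson_F\<^esub> g) x = (g \<otimes>\<^bsub>thompson_F\<^esub> f) x"
    using G x by (simp add: thompson_mult_apply)
qed

lemma fixator_independent:
  assumes f: "f \<in> fixator {t..1}" "f \<noteq> \<one>\<^bsub>thompson_F\<^esub>"
    and g: "g \<in> fixator {0..t}" "g \<noteq> \<one>\<^bsub>thompson_F\<^esub>" and t: "t \<in> {0..1}"
    and eq: "f [^]\<^bsub>thompson_F\<^esub> (i::nat) \<otimes>\<^bsub>thompson_F\<^esub> g [^]\<^bsub>thompson_F\<^esub> (j::nat) =
      f [^]\<^bsub>thompson_F\<^esub> (k::nat) \<otimes>\<^bsub>thompson_F\<^esub> g [^]\<^bsub>thompson_F\<^esub> (l::nat)"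
  shows "i = k \<and> j = l"
proof (rule thompson.independent_powers[OF _ f(1) _ _ g(1) _ _ eq])
  have inj: "inj (\<lambda>n::nat. h [^]\<^bsub>thompson_F\<^esub> n)"
    if "h \<in> carrier thompson_F" "h \<noteq> \<one>\<^bsub>thompson_F\<^esub>" for h
    using thompson.inj_nat_pow[OF that(1)] thompson_torsion_free[OF that(1)] that(2) by blast
  show "inj (\<lambda>n::nat. f [^]\<^bsub>thompson_F\<^esub> n)" "inj (\<lambda>n::nat. g [^]\<^bsub>thompson_F\<^esub> n)"
    using f g by (auto intro!: inj simp: fixator_def)
  show "fixator {t..1} \<inter> fixator {0..t} \<subseteq> {\<one>\<^bsub>thompson_F\<^esub>}" using fixator_disjoint by blast
qed (use t in \<open>auto intro!: subgroup_fixator\<close>)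

section \<open>Explicit elements with small support\<close>

text \<open>
  The supremum of the three affine maps is the standard generator \<open>x\<^sub>0\<close> rescaled to
  \<open>[c, c + 4w]\<close>; it lies above the identity outside this interval.
\<close>

definition bump :: "real \<Rightarrow> real \<Rightarrow> real \<Rightarrow> real" where
  "bump c w x = min x (max ((x + c) / 2) (max (x - w) (2 * x - c - 4 * w)))"

text \<open>Minima and maxima of strictly increasing affine maps are strictly increasing.\<close>

lemma bump_strict_mono: "x < y \<Longrightarrow> bump c w x < bump c w y"
  by (auto simp: bump_def min_def max_def)

lemma bump_id: "0 \<le> w \<Longrightarrow> x \<le> c \<or> c + 4 * w \<le> x \<Longrightarrow> bump c w x = x"
  by (auto simp: bump_def min_def max_def)

lemma bump_middle: "0 < w \<Longrightarrow> bump c w (c + 2 * w) = c + w"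
  by (auto simp: bump_def min_def max_def)

lemma bump_pieces:
  assumes "0 < w"
  shows "x \<in> {c..c + 2 * w} \<Longrightarrow> bump c w x = (x + c) / 2"
    and "x \<in> {c + 2 * w..c + 3 * w} \<Longrightarrow> bump c w x = x - w"
    and "x \<in> {c + 3 * w..c + 4 * w} \<Longrightarrow> bump c w x = 2 * x - c - 4 * w"
  using assms by (auto simp: bump_def min_def max_def)

lemma dyadic_PL_bump:
  assumes w: "0 < w" and d: "c \<in> dyadic" "w \<in> dyadic"
  shows "dyadic_PL (restrict (bump c w) {0..1})"
proof -
  have affine: "\<exists>(k::int) e. \<forall>x\<in>{a..b}. restrict (bump c w) {0..1} x = 2 powi k * x + e"
    if "0 \<le> a" "b \<le> 1" "\<And>x. x \<in> {a..b} \<Longrightarrow> bump c w x = 2 powi k * x + e" for a b e and k :: int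
    using that by (intro exI[of _ k] exI[of _ e]) auto
  have mult: "c + real n * w \<in> dyadic" for n
  proof (induction n)
    case (Suc n)
    have "c + real (Suc n) * w = (c + real n * w) + w" by (simp add: algebra_simps)
    then show ?case using dyadic_add[OF Suc d(2)] by (simp only:)
  qed (use d in simp)
  show ?thesis
    unfolding dyadic_PL_def
  proof (intro exI[of _ "{c, c + 2 * w, c + 3 * w, c + 4 * w}"] conjI allI impI)
    show "{c, c + 2 * w, c + 3 * w, c + 4 * w} \<subseteq> dyadic"
      using d(1) mult[of 2] mult[of 3] mult[of 4] by simp
    fix a b :: real
    assume ab: "0 \<le> a \<and> a < b \<and> b \<le> 1 \<and> {a<..<b} \<inter> {c, c + 2 * w, c + 3 * w, c + 4 * w} = {}"
    \<comment> \<open>An interval whose interior misses a breakpoint lies on one side of it. This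
      gives five cases, with slopes \<open>1\<close>, \<open>1\<close>, \<open>1 / 2\<close>,
      \<open>1\<close> and \<open>2\<close>.\<close>
    have out: "b \<le> z \<or> z \<le> a" if "z \<in> {c, c + 2 * w, c + 3 * w, c + 4 * w}" for z
      using ab that by fastforce
    consider "b \<le> c" | "c + 4 * w \<le> a" | "c \<le> a" "b \<le> c + 2 * w"
      | "c + 2 * w \<le> a" "b \<le> c + 3 * w" | "c + 3 * w \<le> a" "b \<le> c + 4 * w"
      using out[of c] out[of "c + 2 * w"] out[of "c + 3 * w"] out[of "c + 4 * w"] by auto
    then show "\<exists>(k::int) e. \<forall>x\<in>{a..b}. restrict (bump c w) {0..1} x = 2 powi k * x + e"
    proof cases
      case 1
      then show ?thesis using ab w by (intro affine[of _ _ 0 0]) (auto simp: bump_id)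
    next
      case 2
      then show ?thesis using ab w by (intro affine[of _ _ 0 0]) (auto simp: bump_id)
    next
      case 3
      then show ?thesis using ab w
        by (intro affine[of _ _ "- 1" "c / 2"]) (auto simp: bump_pieces(1) power_int_minus field_simps)
    next
      case 4
      then show ?thesis using ab w by (intro affine[of _ _ 0 "- w"]) (auto simp: bump_pieces(2))
    next
      case 5
      then show ?thesis using ab w
        by (intro affine[of _ _ 1 "- c - 4 * w"]) (auto simp: bump_pieces(3))
    qed
  qed simp
qed

lemma bump_thompson:
  assumes w: "0 < w" "0 \<le> c" "c + 4 * w \<le> 1" and d: "c \<in> dyadic" "w \<in> dyadic"
  shows "restrict (bump c w) {0..1} \<in> thompson_carrier"
proof -
  define f where "f = restrict (bump c w) {0..1}"
  have cont: "continuous_on {0..1} (bump c w)"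
    unfolding bump_def by (intro continuous_intros ballI) auto
  have ends: "bump c w 0 = 0" "bump c w 1 = 1" using w by (auto intro!: bump_id)
  have mono: "bump c w x \<le> bump c w y" if "x \<le> y" for x y
    using bump_strict_mono[of x y c w] that by (cases "x = y") auto
  have "bump c w ` {0..1} = {0..1}"
  proof
    show "bump c w ` {0..1} \<subseteq> {0..1}"
      using mono[of 0] mono[of _ 1] ends by (auto simp: image_subset_iff)
    show "{0..1} \<subseteq> bump c w ` {0..1}"
    proof
      fix y :: real assume "y \<in> {0..1}"
      then obtain x where "0 \<le> x" "x \<le> 1" "bump c w x = y"
        using IVT'[of "bump c w" 0 y 1] cont ends by auto
      then show "y \<in> bump c w ` {0..1}" by auto
    qed
  qed
  moreover have "inj_on (bump c w) {0..1}"
    by (rule linorder_inj_onI) (auto dest: bump_strict_mono[of _ _ c w])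
  ultimately obtain g where "homeomorphism {0..1} {0..1} (bump c w) g"
    using homeomorphism_compact[OF compact_Icc cont] by blast
  then have "homeomorphism {0..1} {0..1} f g"
    unfolding f_def by (rule homeomorphism_cong) auto
  moreover have "strict_mono_on {0..1} f"
    unfolding f_def by (auto simp: strict_mono_on_def bump_strict_mono)
  ultimately show ?thesis
    unfolding thompson_carrier_def f_def using dyadic_PL_bump[OF w(1) d] by auto
qed

lemma exists_supported:
  assumes w: "0 < w" "0 \<le> c" "c + 4 * w \<le> 1" and d: "c \<in> dyadic" "w \<in> dyadic"
  shows "\<exists>f. f \<in> fixator {0..c} \<and> f \<in> fixator {c + 4 * w..1} \<and> f \<noteq> \<one>\<^bsub>thompson_F\<^esub>"
proof (intro exI conjI)
  let ?f = "restrict (bump c w) {0..1}"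
  show "?f \<in> fixator {0..c}" "?f \<in> fixator {c + 4 * w..1}"
    using bump_thompson[OF assms] w by (auto simp: fixator_def carrier_thompson bump_id)
  have "?f (c + 2 * w) \<noteq> \<one>\<^bsub>thompson_F\<^esub> (c + 2 * w)"
    using w by (simp add: thompson_one bump_middle)
  then show "?f \<noteq> \<one>\<^bsub>thompson_F\<^esub>" by (rule contrapos_nn) (simp only:)
qed

lemma exists_supported_near_one:
  assumes t: "t < 1"
  shows "\<exists>f. f \<in> fixator {0..t} \<and> f \<noteq> \<one>\<^bsub>thompson_F\<^esub>"
proof -
  obtain n where n: "(1 / 2 :: real) ^ n < 1 - t"
    using real_arch_pow_inv[of "1 - t" "1 / 2"] t by auto
  \<comment> \<open>Then \<open>4 * w\<close> is a power of \<open>1 / 2\<close> below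
    \<open>1 - t\<close>, so the interval \<open>[1 - 4 * w, 1]\<close> has dyadic ends and lies to
    the right of \<open>t\<close>.\<close>
  define w where "w = (1 / 2 :: real) ^ (n + 2)"
  have w4: "4 * w = (1 / 2) ^ n" by (simp add: w_def)
  have "w = of_int 1 / 2 ^ (n + 2)" by (simp add: w_def power_one_over)
  then have wd: "w \<in> dyadic" unfolding dyadic_def by blast
  have "(1 / 2 :: real) ^ n = of_int 1 / 2 ^ n" by (simp add: power_one_over)
  then have "(1 / 2 :: real) ^ n \<in> dyadic" unfolding dyadic_def by blast
  then have cd: "1 - 4 * w \<in> dyadic"
    unfolding w4 using dyadic_add[OF dyadic_1 dyadic_minus] by fastforce
  have "(1 / 2 :: real) ^ n \<le> 1" by (simp add: power_le_one)
  then have "0 \<le> 1 - 4 * w" using w4 by simp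
  moreover have "0 < w" by (simp add: w_def)
  ultimately obtain f where f: "f \<in> fixator {0..1 - 4 * w}" "f \<noteq> \<one>\<^bsub>thompson_F\<^esub>"
    using exists_supported[of w "1 - 4 * w"] cd wd by auto
  have "{0..t} \<subseteq> {0..1 - 4 * w}" using n w4 by auto
  then have "f \<in> fixator {0..t}" using f(1) by (auto simp: fixator_def)
  then show ?thesis using f(2) by blast
qed

text \<open>Conjugation by \<open>h\<close> carries a support in \<open>[0, t]\<close> into
  \<open>[0, h t]\<close>: for \<open>x \<ge> h t\<close> the point \<open>y\<close> with
  \<open>h y = x\<close> satisfies \<open>y \<ge> t\<close> and is fixed by
  \<open>a\<close>.\<close>

lemma conjugate_fixator:
  assumes a: "a \<in> fixator {t..1}" and h: "h \<in> carrier thompson_F" and t: "t \<in> {0..1}"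
  shows "h \<otimes>\<^bsub>thompson_F\<^esub> a \<otimes>\<^bsub>thompson_F\<^esub> inv\<^bsub>thompson_F\<^esub> h \<in> fixator {h t..1}"
proof -
  have aG: "a \<in> carrier thompson_F" using a by (simp add: fixator_def)
  have hC: "h \<in> thompson_carrier" using h by (simp add: carrier_thompson)
  have "(h \<otimes>\<^bsub>thompson_F\<^esub> a \<otimes>\<^bsub>thompson_F\<^esub> inv\<^bsub>thompson_F\<^esub> h) x = x" if x: "x \<in> {h t..1}" for x
  proof -
    have x01: "x \<in> {0..1}" using x thompson_range[OF hC t] by auto
    define y where "y = (inv\<^bsub>thompson_F\<^esub> h) x"
    have y01: "y \<in> {0..1}"
      unfolding y_def using thompson_range[OF _ x01] thompson.inv_closed[OF h]
      by (simp add: carrier_thompson)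
    have hy: "h y = x"
      unfolding y_def
      using thompson_mult_apply[OF h thompson.inv_closed[OF h] x01] thompson.r_inv[OF h] x01
      by (simp add: thompson_one)
    have "t \<le> y" using thompson_less_iff[OF hC y01 t] hy x by auto
    then have "a y = y" using a y01 by (auto simp: fixator_def)
    then show ?thesis
      using hy y01 x01 h aG by (simp add: thompson_mult_apply y_def[symmetric])
  qed
  then show ?thesis using h aG by (simp add: fixator_def)
qed

theorem proposition20:
  shows "not_strongly_relatively_hyperbolic TYPE('v) thompson_F"
proof -
  \<comment> \<open>With \<open>c = 0\<close> and \<open>w = 1 / 8\<close> the support lies in
    \<open>[0, 1 / 2]\<close>.\<close>
  have "(1 / 8 :: real) = of_int 1 / 2 ^ 3" by simp
  then have "(1 / 8 :: real) \<in> dyadic" unfolding dyadic_def by blast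
  then obtain a where a: "a \<in> fixator {1 / 2..1}" "a \<noteq> \<one>\<^bsub>thompson_F\<^esub>"
    using exists_supported[of "1 / 8" 0] dyadic_0 by auto
  obtain b where b: "b \<in> fixator {0..1 / 2}" "b \<noteq> \<one>\<^bsub>thompson_F\<^esub>"
    using exists_supported_near_one[of "1 / 2"] by auto
  have half: "1 / 2 \<in> {0..1 :: real}" by simp
  have G: "a \<in> carrier thompson_F" "b \<in> carrier thompson_F"
    using a b by (auto simp: fixator_def)
  show ?thesis
  proof (rule thompson.not_strongly_relatively_hyperbolicI[OF thompson_torsion_free G(1) a(2) G(2)])
    show "a \<otimes>\<^bsub>thompson_F\<^esub> b = b \<otimes>\<^bsub>thompson_F\<^esub> a" by (rule fixator_commute[OF a(1) b(1) half])
  next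
    fix i j k l :: nat
    assume "a [^]\<^bsub>thompson_F\<^esub> i \<otimes>\<^bsub>thompson_F\<^esub> b [^]\<^bsub>thompson_F\<^esub> j =
      a [^]\<^bsub>thompson_F\<^esub> k \<otimes>\<^bsub>thompson_F\<^esub> b [^]\<^bsub>thompson_F\<^esub> l"
    then show "i = k \<and> j = l" by (rule fixator_independent[OF a b half])
  next
    fix h assume h: "h \<in> carrier thompson_F"
    then have hC: "h \<in> thompson_carrier" by (simp add: carrier_thompson)
    have h1: "h (1 / 2) \<in> {0..1}" by (rule thompson_range[OF hC half])
    \<comment> \<open>This leaves room near 1 for an element \<open>z\<close> supported to the right
      of both \<open>a\<close> and its conjugate by \<open>h\<close>.\<close>
    have "h (1 / 2) < 1"
      using thompson_less_iff[OF hC half, of 1] thompson_endpoints(2)[OF hC] by simp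
    then obtain z where z: "z \<in> fixator {0..max (1 / 2) (h (1 / 2))}" "z \<noteq> \<one>\<^bsub>thompson_F\<^esub>"
      using exists_supported_near_one[of "max (1 / 2) (h (1 / 2))"] by auto
    then have "z \<in> fixator {0..1 / 2}" "z \<in> fixator {0..h (1 / 2)}" by (auto simp: fixator_def)
    then have "a \<otimes>\<^bsub>thompson_F\<^esub> z = z \<otimes>\<^bsub>thompson_F\<^esub> a"
      "(h \<otimes>\<^bsub>thompson_F\<^esub> a \<otimes>\<^bsub>thompson_F\<^esub> inv\<^bsub>thompson_F\<^esub> h) \<otimes>\<^bsub>thompson_F\<^esub> z =
        z \<otimes>\<^bsub>thompson_F\<^esub> (h \<otimes>\<^bsub>thompson_F\<^esub> a \<otimes>\<^bsub>thompson_F\<^esub> inv\<^bsub>thompson_F\<^esub> h)"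
      using fixator_commute[OF a(1) _ half] fixator_commute[OF conjugate_fixator[OF a(1) h half] _ h1]
      by blast+
    moreover have "z \<in> carrier thompson_F" using z by (simp add: fixator_def)
    ultimately show "\<exists>z\<in>carrier thompson_F. z \<noteq> \<one>\<^bsub>thompson_F\<^esub> \<and>
        z \<otimes>\<^bsub>thompson_F\<^esub> a = a \<otimes>\<^bsub>thompson_F\<^esub> z \<and>
        z \<otimes>\<^bsub>thompson_F\<^esub> (h \<otimes>\<^bsub>thompson_F\<^esub> a \<otimes>\<^bsub>thompson_F\<^esub> inv\<^bsub>thompson_F\<^esub> h) =
          (h \<otimes>\<^bsub>thompson_F\<^esub> a \<otimes>\<^bsub>thompson_F\<^esub> inv\<^bsub>thompson_F\<^esub> h) \<otimes>\<^bsub>thompson_F\<^esub> z"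
      using z(2) by (intro bexI[of _ z]) auto
  qed
qed

end
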